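(* Let $\Gamma$ be a finite simply laced graph, $\mathbb{K}$ a commutative ring, and $\{s_{ij}\}$ invertible elements of $\mathbb{K}$ indexed by the edges of $\Gamma$ (with $s_{ij}=s_{ji}$). Then the generalized Laplace operator $\Delta=1+\sum s_{ij}l_{ij}$ (sum over all oriented edges $(ij)$ of $\Gamma$) is a well-tempered element of the algebra $\mathbb{K}\Gamma$.
   Context: Simply laced: no loops and no multiple edges. Algebra $\mathbb{K}\Gamma$ of the Poincaré groupoid: the $\mathbb{K}$-algebra with free $\mathbb{K}$-basis the homotopy classes (with fixed endpoints) of paths between vertices in $\Gamma$, with multiplication induced by concatenation of paths (zero when paths cannot be concatenated). $l_{ij}$ is the class of the oriented edge $(ij)$; $e_i$ is the class of the constant path at $i$, and the unit is $1=\sum_i e_i$. Homotope: for a unital associative $\mathbb{K}$-algebra $A$ and $\Delta\in A$, $B^+=A_\Delta$ is the algebra with underlying module $A$ and multiplication $a\cdot_\Delta b=a\Delta b$; $B=\widehat{A}_\Delta=\mathbb{K}\cdot 1\oplus B^+$ is obtained by adjoining a unit, so $B^+$ is a two-sided ideal of $B$. Well-tempered: $\Delta\in A$ is well-tempered if the multiplication map $B^+\otimes_{\mathbb{K}}B^+\to B^+$ is surjective (equivalently $A\Delta A=A$, where $A\Delta A$ is the two-sided ideal generated by $\Delta$) and $B^+$ is projective both as a left and as a right $B$-module. *)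

theory Defs
  imports "HOL-Algebra.Algebra" "Graph_Theory.Graph_Theory"
begin

section \<open>The algebra of the Poincare groupoid\<close>

type_synonym 'v path = "'v \<times> ('v \<times> 'v) awalk \<times> 'v"

definition paths :: "'v pair_pre_digraph \<Rightarrow> 'v path set" where
  "paths G = {(u, p, v). pre_digraph.awalk (with_proj G) u p v}"

inductive backtrack :: "'v pair_pre_digraph \<Rightarrow> 'v path \<Rightarrow> 'v path \<Rightarrow> bool" for G where
  "(u, p @ (a, b) # (b, a) # q, v) \<in> paths G
     \<Longrightarrow> backtrack G (u, p @ (a, b) # (b, a) # q, v) (u, p @ q, v)"

text \<open>Two edge paths are homotopic relative to their endpoints iff they are related by finitely many
  insertions and deletions of backtracks.\<close>

definition homotopy :: "'v pair_pre_digraph \<Rightarrow> ('v path \<times> 'v path) set" where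
  "homotopy G = {(x, y). x \<in> paths G \<and> y \<in> paths G \<and> equivclp (backtrack G) x y}"

definition poincare_classes :: "'v pair_pre_digraph \<Rightarrow> 'v path set set" where
  "poincare_classes G = paths G // homotopy G"

definition hclass :: "'v pair_pre_digraph \<Rightarrow> 'v path \<Rightarrow> 'v path set" where
  "hclass G x = homotopy G `` {x}"

text \<open>On homotopy classes this is concatenation; if the two classes cannot be concatenated, the
  value is the empty set, which is not a homotopy class.\<close>

definition hconcat :: "'v pair_pre_digraph \<Rightarrow> 'v path set \<Rightarrow> 'v path set \<Rightarrow> 'v path set" where
  "hconcat G c d = homotopy G `` {(u, p @ q, w) | u p v q w. (u, p, v) \<in> c \<and> (v, q, w) \<in> d}"

definition basis_elt :: "('k, 'c) ring_scheme \<Rightarrow> 'b \<Rightarrow> 'b \<Rightarrow> 'k" where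
  "basis_elt K c = (\<lambda>x. if x = c then \<one>\<^bsub>K\<^esub> else \<zero>\<^bsub>K\<^esub>)"

text \<open>Elements of the free module on the homotopy classes are coefficient functions of finite
  support. The unit is the sum of the classes of the constant paths.\<close>

definition poincare_algebra ::
  "('k, 'c) ring_scheme \<Rightarrow> 'v pair_pre_digraph \<Rightarrow> ('k, 'v path set \<Rightarrow> 'k) module" where
  "poincare_algebra K G =
    \<lparr>carrier = {f. (\<forall>x. f x \<in> carrier K) \<and> (\<forall>x. x \<notin> poincare_classes G \<longrightarrow> f x = \<zero>\<^bsub>K\<^esub>)
                 \<and> finite {x. f x \<noteq> \<zero>\<^bsub>K\<^esub>}},
     monoid.mult = (\<lambda>f g x. if x \<in> poincare_classes G
        then finsum K (\<lambda>(c, d). f c \<otimes>\<^bsub>K\<^esub> g d)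
          {(c, d). f c \<noteq> \<zero>\<^bsub>K\<^esub> \<and> g d \<noteq> \<zero>\<^bsub>K\<^esub> \<and> hconcat G c d = x}
        else \<zero>\<^bsub>K\<^esub>),
     one = (\<lambda>x. if x \<in> (\<lambda>i. hclass G (i, [], i)) ` pverts G then \<one>\<^bsub>K\<^esub> else \<zero>\<^bsub>K\<^esub>),
     ring.zero = (\<lambda>x. \<zero>\<^bsub>K\<^esub>),
     add = (\<lambda>f g x. f x \<oplus>\<^bsub>K\<^esub> g x),
     smult = (\<lambda>a f x. a \<otimes>\<^bsub>K\<^esub> f x)\<rparr>"

definition edge_elt ::
  "('k, 'c) ring_scheme \<Rightarrow> 'v pair_pre_digraph \<Rightarrow> 'v \<Rightarrow> 'v \<Rightarrow> 'v path set \<Rightarrow> 'k" where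
  "edge_elt K G i j = basis_elt K (hclass G (i, [(i, j)], j))"

definition laplace ::
  "('k, 'c) ring_scheme \<Rightarrow> 'v pair_pre_digraph \<Rightarrow> ('v \<Rightarrow> 'v \<Rightarrow> 'k) \<Rightarrow> 'v path set \<Rightarrow> 'k" where
  "laplace K G s = \<one>\<^bsub>poincare_algebra K G\<^esub> \<oplus>\<^bsub>poincare_algebra K G\<^esub>
     finsum (poincare_algebra K G)
       (\<lambda>(i, j). s i j \<odot>\<^bsub>poincare_algebra K G\<^esub> edge_elt K G i j) (parcs G)"

section \<open>Algebras and modules over noncommutative rings\<close>

text \<open>The library's locale \<open>algebra\<close> requires commutative algebras and its locale \<open>module\<close>
  requires a commutative base ring.\<close>

locale assoc_algebra = Module.module K A + A?: ring A
  for K :: "('k, 'c) ring_scheme" (structure) and A :: "('k, 'a, 'd) module_scheme" (structure) +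
  assumes smult_mult_left: "\<lbrakk>k \<in> carrier K; x \<in> carrier A; y \<in> carrier A\<rbrakk>
      \<Longrightarrow> (k \<odot>\<^bsub>A\<^esub> x) \<otimes>\<^bsub>A\<^esub> y = k \<odot>\<^bsub>A\<^esub> (x \<otimes>\<^bsub>A\<^esub> y)"
    and smult_mult_right: "\<lbrakk>k \<in> carrier K; x \<in> carrier A; y \<in> carrier A\<rbrakk>
      \<Longrightarrow> x \<otimes>\<^bsub>A\<^esub> (k \<odot>\<^bsub>A\<^esub> y) = k \<odot>\<^bsub>A\<^esub> (x \<otimes>\<^bsub>A\<^esub> y)"

locale left_module = R?: ring R + M?: abelian_group M
  for R :: "('r, 'c) ring_scheme" (structure) and M :: "('r, 'm, 'd) module_scheme" (structure) +
  assumes smult_closed: "\<lbrakk>a \<in> carrier R; x \<in> carrier M\<rbrakk> \<Longrightarrow> a \<odot>\<^bsub>M\<^esub> x \<in> carrier M"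
    and smult_l_distr: "\<lbrakk>a \<in> carrier R; b \<in> carrier R; x \<in> carrier M\<rbrakk>
      \<Longrightarrow> (a \<oplus>\<^bsub>R\<^esub> b) \<odot>\<^bsub>M\<^esub> x = a \<odot>\<^bsub>M\<^esub> x \<oplus>\<^bsub>M\<^esub> b \<odot>\<^bsub>M\<^esub> x"
    and smult_r_distr: "\<lbrakk>a \<in> carrier R; x \<in> carrier M; y \<in> carrier M\<rbrakk>
      \<Longrightarrow> a \<odot>\<^bsub>M\<^esub> (x \<oplus>\<^bsub>M\<^esub> y) = a \<odot>\<^bsub>M\<^esub> x \<oplus>\<^bsub>M\<^esub> a \<odot>\<^bsub>M\<^esub> y"
    and smult_assoc: "\<lbrakk>a \<in> carrier R; b \<in> carrier R; x \<in> carrier M\<rbrakk>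
      \<Longrightarrow> (a \<otimes>\<^bsub>R\<^esub> b) \<odot>\<^bsub>M\<^esub> x = a \<odot>\<^bsub>M\<^esub> (b \<odot>\<^bsub>M\<^esub> x)"
    and smult_one: "x \<in> carrier M \<Longrightarrow> \<one>\<^bsub>R\<^esub> \<odot>\<^bsub>M\<^esub> x = x"

definition left_module_hom ::
  "('r, 'c) ring_scheme \<Rightarrow> ('r, 'm, 'd) module_scheme \<Rightarrow> ('r, 'n, 'e) module_scheme
    \<Rightarrow> ('m \<Rightarrow> 'n) set" where
  "left_module_hom R M N = {h \<in> carrier M \<rightarrow> carrier N.
     (\<forall>x\<in>carrier M. \<forall>y\<in>carrier M. h (x \<oplus>\<^bsub>M\<^esub> y) = h x \<oplus>\<^bsub>N\<^esub> h y) \<and>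
     (\<forall>a\<in>carrier R. \<forall>x\<in>carrier M. h (a \<odot>\<^bsub>M\<^esub> x) = a \<odot>\<^bsub>N\<^esub> h x)}"

text \<open>The lifting property against all surjections between modules whose elements have types
  \<open>'m\<close> and \<open>'n\<close>. HOL cannot quantify over types inside a definition; a theorem concluding
  \<open>projective TYPE('m) TYPE('n) R P\<close> for type variables \<open>'m\<close> and \<open>'n\<close> that occur nowhere else
  asserts the lifting property against all modules.\<close>

definition projective ::
  "'m itself \<Rightarrow> 'n itself \<Rightarrow> ('r, 'c) ring_scheme \<Rightarrow> ('r, 'p, 'd) module_scheme \<Rightarrow> bool" where
  "projective _ _ R P \<longleftrightarrow> left_module R P \<and>
     (\<forall>(M :: ('r, 'm) module) (N :: ('r, 'n) module) f g.
        left_module R M \<and> left_module R N \<and>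
        f \<in> left_module_hom R M N \<and> f ` carrier M = carrier N \<and> g \<in> left_module_hom R P N
        \<longrightarrow> (\<exists>h\<in>left_module_hom R P M. \<forall>x\<in>carrier P. f (h x) = g x))"

text \<open>Right \<open>R\<close>-modules are left modules over the opposite ring.\<close>

definition opposite :: "('r, 'c) ring_scheme \<Rightarrow> ('r, 'c) ring_scheme" where
  "opposite R = R\<lparr>monoid.mult := \<lambda>x y. y \<otimes>\<^bsub>R\<^esub> x\<rparr>"

text \<open>A left ideal as a left module; the fields \<open>mult\<close> and \<open>one\<close> play no role.\<close>

definition ideal_module :: "('r, 'c) ring_scheme \<Rightarrow> 'r set \<Rightarrow> ('r, 'r) module" where
  "ideal_module R I = \<lparr>carrier = I, monoid.mult = monoid.mult R, one = \<one>\<^bsub>R\<^esub>, ring.zero = \<zero>\<^bsub>R\<^esub>,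
     add = add R, smult = monoid.mult R\<rparr>"

section \<open>Tensor products\<close>

text \<open>The tensor product of two \<open>K\<close>-modules, as an abelian group: the free abelian group on pairs
  modulo biadditivity and \<open>K\<close>-balancedness.\<close>

definition tensor_relations ::
  "('k, 'c) ring_scheme \<Rightarrow> ('k, 'm, 'd) module_scheme \<Rightarrow> ('k, 'n, 'e) module_scheme
    \<Rightarrow> ('m \<times> 'n \<Rightarrow>\<^sub>0 int) set" where
  "tensor_relations K M N =
     {frag_of (x \<oplus>\<^bsub>M\<^esub> x', y) - frag_of (x, y) - frag_of (x', y) | x x' y.
        x \<in> carrier M \<and> x' \<in> carrier M \<and> y \<in> carrier N} \<union>
     {frag_of (x, y \<oplus>\<^bsub>N\<^esub> y') - frag_of (x, y) - frag_of (x, y') | x y y'.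
        x \<in> carrier M \<and> y \<in> carrier N \<and> y' \<in> carrier N} \<union>
     {frag_of (a \<odot>\<^bsub>M\<^esub> x, y) - frag_of (x, a \<odot>\<^bsub>N\<^esub> y) | a x y.
        a \<in> carrier K \<and> x \<in> carrier M \<and> y \<in> carrier N}"

definition tensor_kernel ::
  "('k, 'c) ring_scheme \<Rightarrow> ('k, 'm, 'd) module_scheme \<Rightarrow> ('k, 'n, 'e) module_scheme
    \<Rightarrow> ('m \<times> 'n \<Rightarrow>\<^sub>0 int) set" where
  "tensor_kernel K M N =
     generate (free_Abelian_group (carrier M \<times> carrier N)) (tensor_relations K M N)"

definition tensor_product ::
  "('k, 'c) ring_scheme \<Rightarrow> ('k, 'm, 'd) module_scheme \<Rightarrow> ('k, 'n, 'e) module_scheme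
    \<Rightarrow> ('m \<times> 'n \<Rightarrow>\<^sub>0 int) set monoid" where
  "tensor_product K M N = free_Abelian_group (carrier M \<times> carrier N) Mod tensor_kernel K M N"

definition pure_tensor ::
  "('k, 'c) ring_scheme \<Rightarrow> ('k, 'm, 'd) module_scheme \<Rightarrow> ('k, 'n, 'e) module_scheme
    \<Rightarrow> 'm \<Rightarrow> 'n \<Rightarrow> ('m \<times> 'n \<Rightarrow>\<^sub>0 int) set" where
  "pure_tensor K M N x y =
     tensor_kernel K M N #>\<^bsub>free_Abelian_group (carrier M \<times> carrier N)\<^esub> frag_of (x, y)"

text \<open>The homomorphism \<open>\<mu>\<close> is unique because the pure tensors generate the tensor product.\<close>

definition mult_map_surjective ::
  "('k, 'c) ring_scheme \<Rightarrow> ('k, 'a, 'd) module_scheme \<Rightarrow> bool" where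
  "mult_map_surjective K M \<longleftrightarrow>
     (\<exists>\<mu>\<in>hom (tensor_product K M M) (add_monoid M).
        (\<forall>x\<in>carrier M. \<forall>y\<in>carrier M. \<mu> (pure_tensor K M M x y) = x \<otimes>\<^bsub>M\<^esub> y) \<and>
        \<mu> ` carrier (tensor_product K M M) = carrier M)"

section \<open>Homotopes and well-tempered elements\<close>

text \<open>The homotope need not be unital: its field \<open>one\<close>, inherited from \<open>A\<close>, plays no role.\<close>

definition homotope :: "('k, 'a) module \<Rightarrow> 'a \<Rightarrow> ('k, 'a) module" where
  "homotope A \<Delta> = A\<lparr>monoid.mult := \<lambda>x y. x \<otimes>\<^bsub>A\<^esub> \<Delta> \<otimes>\<^bsub>A\<^esub> y\<rparr>"

definition adjoin_unit :: "('k, 'c) ring_scheme \<Rightarrow> ('k, 'a) module \<Rightarrow> ('k, 'k \<times> 'a) module" where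
  "adjoin_unit K C =
    \<lparr>carrier = carrier K \<times> carrier C,
     monoid.mult = (\<lambda>(k, x) (l, y). (k \<otimes>\<^bsub>K\<^esub> l, k \<odot>\<^bsub>C\<^esub> y \<oplus>\<^bsub>C\<^esub> l \<odot>\<^bsub>C\<^esub> x \<oplus>\<^bsub>C\<^esub> x \<otimes>\<^bsub>C\<^esub> y)),
     one = (\<one>\<^bsub>K\<^esub>, \<zero>\<^bsub>C\<^esub>),
     ring.zero = (\<zero>\<^bsub>K\<^esub>, \<zero>\<^bsub>C\<^esub>),
     add = (\<lambda>(k, x) (l, y). (k \<oplus>\<^bsub>K\<^esub> l, x \<oplus>\<^bsub>C\<^esub> y)),
     smult = (\<lambda>a (k, x). (a \<otimes>\<^bsub>K\<^esub> k, a \<odot>\<^bsub>C\<^esub> x))\<rparr>"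

definition augmentation_ideal :: "('k, 'c) ring_scheme \<Rightarrow> ('k, 'a) module \<Rightarrow> ('k \<times> 'a) set" where
  "augmentation_ideal K C = {\<zero>\<^bsub>K\<^esub>} \<times> carrier C"

definition well_tempered ::
  "'m itself \<Rightarrow> 'n itself \<Rightarrow> ('k, 'c) ring_scheme \<Rightarrow> ('k, 'a) module \<Rightarrow> 'a \<Rightarrow> bool" where
  "well_tempered TM TN K A \<Delta> \<longleftrightarrow> assoc_algebra K A \<and> \<Delta> \<in> carrier A \<and>
     (let C = homotope A \<Delta>; B = adjoin_unit K C; I = augmentation_ideal K C
      in mult_map_surjective K C \<and>
         projective TM TN B (ideal_module B I) \<and>
         projective TM TN (opposite B) (ideal_module (opposite B) I))"

end

theory Submission
  imports Defs
begin

text \<open>Let \<open>e\<^sub>i\<close> be the class of the constant path at \<open>i\<close>. As the graph has no loops,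
  \<open>e\<^sub>i \<Delta> e\<^sub>i = e\<^sub>i\<close>. Since the \<open>e\<^sub>i\<close> sum up to \<open>1\<close>, every \<open>x\<close> satisfies
  \<open>x = (\<Sum>i. (x e\<^sub>i) \<Delta> e\<^sub>i) = (\<Sum>i. e\<^sub>i \<Delta> (e\<^sub>i x))\<close>. So the multiplication of \<open>B\<^sup>+\<close> is surjective, and
  the \<open>e\<^sub>i\<close> together with the maps \<open>x \<mapsto> x e\<^sub>i\<close> from \<open>B\<^sup>+\<close> to \<open>B\<close> (on the right, \<open>x \<mapsto> e\<^sub>i x\<close>)
  form a finite dual basis of \<open>B\<^sup>+\<close>.\<close>

section \<open>Projective modules and surjective multiplication maps\<close>

text \<open>The factor \<Delta> consumed by the corner identity is supplied by the module structure:
  the coordinate maps take values in the ideal \<open>B\<^sup>+\<close>, where the scalar part is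
  zero, so that acting with such a value on \<open>e\<^sub>i\<close> is multiplication in the
  homotope. The corner identity itself is read off from coefficients. Multiplying by
  \<open>e\<^sub>i\<close> on both sides keeps the classes of all closed paths at i, homotopically
  nontrivial ones included, and an edge class is never among them because homotopy preserves
  endpoints. Endpoints are the only homotopy invariant involved; no normal form of paths occurs.

  Most of the work lies in showing that the groupoid algebra is an associative unital algebra. Its
  product is a sum over the pairs of classes in the supports with a prescribed concatenation, so the
  index set varies with the factors and with the coefficient. Rewritten over any finite rectangle
  containing the supports, with a Kronecker factor, it becomes a double sum that can be interchanged
  with others. The empty set, returned for pairs that cannot be concatenated, behaves as a
  zero.\<close>

lemma additive_hom_finsum:
  assumes "abelian_group M" "abelian_group N" "h \<in> carrier M \<rightarrow> carrier N"
    and add: "\<And>x y. \<lbrakk>x \<in> carrier M; y \<in> carrier M\<rbrakk> \<Longrightarrow> h (x \<oplus>\<^bsub>M\<^esub> y) = h x \<oplus>\<^bsub>N\<^esub> h y"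
    and "F \<in> I \<rightarrow> carrier M"
  shows "h (finsum M F I) = finsum N (\<lambda>i. h (F i)) I"
proof -
  interpret M: abelian_group M by fact
  interpret N: abelian_group N by fact
  have zero: "h \<zero>\<^bsub>M\<^esub> = \<zero>\<^bsub>N\<^esub>"
    using add[of "\<zero>\<^bsub>M\<^esub>" "\<zero>\<^bsub>M\<^esub>"] assms(3) N.add.l_cancel_one[of "h \<zero>\<^bsub>M\<^esub>" "h \<zero>\<^bsub>M\<^esub>"] by fastforce
  show ?thesis
    using assms(5)
  \<comment> \<open>A sum over an infinite set is zero by convention, so \<open>zero\<close> settles
    that case together with the empty one.\<close>
  proof (induct I rule: infinite_finite_induct)
    case (insert i I)
    moreover from this have "F \<in> I \<rightarrow> carrier M" "F i \<in> carrier M" by auto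
    moreover have "(\<lambda>i. h (F i)) \<in> I \<rightarrow> carrier N" "h (F i) \<in> carrier N"
      using calculation assms(3) by fastforce+
    ultimately show ?case by (simp add: add)
  qed (simp_all add: zero)
qed

text \<open>The easy half of the dual basis lemma: lift the images \<open>g (e i)\<close> through
  \<open>f\<close> and recombine the lifts with the coordinates \<open>\<phi> i x\<close>. The
  right-hand statement is the same lemma over the opposite ring.\<close>

lemma projective_dual_basis:
  fixes R :: "('r, 'c) ring_scheme" and P :: "('r, 'p, 'd) module_scheme"
  assumes P: "left_module R P" and fin: "finite I" and e: "e \<in> I \<rightarrow> carrier P"
    and \<phi>: "\<And>i. i \<in> I \<Longrightarrow> \<phi> i \<in> left_module_hom R P (ideal_module R (carrier R))"
    and basis: "\<And>x. x \<in> carrier P \<Longrightarrow> x = finsum P (\<lambda>i. \<phi> i x \<odot>\<^bsub>P\<^esub> e i) I"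
  shows "projective TYPE('m) TYPE('n) R P"
  unfolding projective_def
proof (intro conjI allI impI P)
  fix M :: "('r, 'm) module" and N :: "('r, 'n) module" and f g
  assume *: "left_module R M \<and> left_module R N \<and> f \<in> left_module_hom R M N \<and>
    f ` carrier M = carrier N \<and> g \<in> left_module_hom R P N"
  interpret P: left_module R P by fact
  interpret M: left_module R M using * by blast
  interpret N: left_module R N using * by blast
  have f: "f \<in> carrier M \<rightarrow> carrier N"
    "\<And>x y. x \<in> carrier M \<Longrightarrow> y \<in> carrier M \<Longrightarrow> f (x \<oplus>\<^bsub>M\<^esub> y) = f x \<oplus>\<^bsub>N\<^esub> f y"
    "\<And>a x. a \<in> carrier R \<Longrightarrow> x \<in> carrier M \<Longrightarrow> f (a \<odot>\<^bsub>M\<^esub> x) = a \<odot>\<^bsub>N\<^esub> f x"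
    using * by (auto simp: left_module_hom_def)
  have g: "g \<in> carrier P \<rightarrow> carrier N"
    "\<And>x y. x \<in> carrier P \<Longrightarrow> y \<in> carrier P \<Longrightarrow> g (x \<oplus>\<^bsub>P\<^esub> y) = g x \<oplus>\<^bsub>N\<^esub> g y"
    "\<And>a x. a \<in> carrier R \<Longrightarrow> x \<in> carrier P \<Longrightarrow> g (a \<odot>\<^bsub>P\<^esub> x) = a \<odot>\<^bsub>N\<^esub> g x"
    using * by (auto simp: left_module_hom_def)
  have \<phi>': "\<phi> i x \<in> carrier R" "\<phi> i (x \<oplus>\<^bsub>P\<^esub> y) = \<phi> i x \<oplus>\<^bsub>R\<^esub> \<phi> i y"
    "a \<in> carrier R \<Longrightarrow> \<phi> i (a \<odot>\<^bsub>P\<^esub> x) = a \<otimes>\<^bsub>R\<^esub> \<phi> i x"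
    if "i \<in> I" "x \<in> carrier P" "y \<in> carrier P" for i x y a
    using \<phi>[OF that(1)] that by (auto simp: left_module_hom_def ideal_module_def)
  have "\<forall>i\<in>I. \<exists>m. m \<in> carrier M \<and> f m = g (e i)"
  proof
    fix i assume "i \<in> I"
    then have "g (e i) \<in> f ` carrier M" using * e g(1) by blast
    then show "\<exists>m. m \<in> carrier M \<and> f m = g (e i)" by force
  qed
  then obtain m where m: "\<And>i. i \<in> I \<Longrightarrow> m i \<in> carrier M" "\<And>i. i \<in> I \<Longrightarrow> f (m i) = g (e i)"
    by metis
  \<comment> \<open>The \<open>e i\<close> may satisfy relations, yet \<open>h\<close> is well
    defined and linear: its coefficients are prescribed by the linear maps \<open>\<phi> i\<close>
    and not read off from some expansion of \<open>x\<close>.\<close>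
  define h where "h x = finsum M (\<lambda>i. \<phi> i x \<odot>\<^bsub>M\<^esub> m i) I" for x
  have summand: "(\<lambda>i. \<phi> i x \<odot>\<^bsub>M\<^esub> m i) \<in> I \<rightarrow> carrier M" if "x \<in> carrier P" for x
    using that \<phi>' m by (auto intro!: M.smult_closed)
  have "h \<in> left_module_hom R P M"
    unfolding left_module_hom_def
  proof (intro CollectI conjI ballI)
    show "h \<in> carrier P \<rightarrow> carrier M"
      using summand by (auto simp: h_def)
  next
    fix x y assume x: "x \<in> carrier P" and y: "y \<in> carrier P"
    have "h (x \<oplus>\<^bsub>P\<^esub> y) = finsum M (\<lambda>i. \<phi> i x \<odot>\<^bsub>M\<^esub> m i \<oplus>\<^bsub>M\<^esub> \<phi> i y \<odot>\<^bsub>M\<^esub> m i) I"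
      unfolding h_def using x y summand \<phi>' m
      by (intro M.finsum_cong') (auto simp: M.smult_l_distr intro!: M.smult_closed)
    also have "\<dots> = h x \<oplus>\<^bsub>M\<^esub> h y"
      unfolding h_def using summand x y by (simp add: M.finsum_addf)
    finally show "h (x \<oplus>\<^bsub>P\<^esub> y) = h x \<oplus>\<^bsub>M\<^esub> h y" .
  next
    fix a x assume a: "a \<in> carrier R" and x: "x \<in> carrier P"
    have "a \<odot>\<^bsub>M\<^esub> h x = finsum M (\<lambda>i. a \<odot>\<^bsub>M\<^esub> (\<phi> i x \<odot>\<^bsub>M\<^esub> m i)) I"
      unfolding h_def
      by (rule additive_hom_finsum[of M M "\<lambda>y. a \<odot>\<^bsub>M\<^esub> y"])
        (use a x summand in \<open>auto simp: M.smult_r_distr M.abelian_group_axioms intro: M.smult_closed\<close>)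
    also have "\<dots> = h (a \<odot>\<^bsub>P\<^esub> x)"
      unfolding h_def using a x summand[OF P.smult_closed[OF a x]] \<phi>' m
      by (intro M.finsum_cong') (auto simp: M.smult_assoc)
    finally show "h (a \<odot>\<^bsub>P\<^esub> x) = a \<odot>\<^bsub>M\<^esub> h x" by simp
  qed
  moreover have "f (h x) = g x" if x: "x \<in> carrier P" for x
  proof -
    have e': "(\<lambda>i. \<phi> i x \<odot>\<^bsub>P\<^esub> e i) \<in> I \<rightarrow> carrier P"
      using e \<phi>' x by (auto intro!: P.smult_closed)
    have "f (h x) = finsum N (\<lambda>i. f (\<phi> i x \<odot>\<^bsub>M\<^esub> m i)) I"
      unfolding h_def
      by (rule additive_hom_finsum) (use f summand x M.abelian_group_axioms N.abelian_group_axioms in auto)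
    also have "\<dots> = finsum N (\<lambda>i. g (\<phi> i x \<odot>\<^bsub>P\<^esub> e i)) I"
    proof (rule N.finsum_cong')
      show "(\<lambda>i. g (\<phi> i x \<odot>\<^bsub>P\<^esub> e i)) \<in> I \<rightarrow> carrier N" using g e' by blast
      fix i assume i: "i \<in> I"
      then have "e i \<in> carrier P" using e by blast
      then show "f (\<phi> i x \<odot>\<^bsub>M\<^esub> m i) = g (\<phi> i x \<odot>\<^bsub>P\<^esub> e i)"
        using f(3) g(3) m \<phi>' i x by simp
    qed simp
    also have "\<dots> = g (finsum P (\<lambda>i. \<phi> i x \<odot>\<^bsub>P\<^esub> e i) I)"
      by (rule additive_hom_finsum[symmetric])
        (use g e' P.abelian_group_axioms N.abelian_group_axioms in auto)
    finally show ?thesis using basis[OF x] by simp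
  qed
  ultimately show "\<exists>h\<in>left_module_hom R P M. \<forall>x\<in>carrier P. f (h x) = g x" by blast
qed

text \<open>The product extends to the free abelian group on pairs, kills the tensor relations and
  hence descends to the quotient; the image is a subgroup containing all products. The assumptions
  are biadditivity and balancedness instead of a ring locale, because a homotope has no unit in
  general.\<close>

lemma mult_map_surjectiveI:
  fixes K :: "('k, 'c) ring_scheme" and C :: "('k, 'a, 'd) module_scheme"
  assumes C: "abelian_group C"
    and smult: "\<And>a x. \<lbrakk>a \<in> carrier K; x \<in> carrier C\<rbrakk> \<Longrightarrow> a \<odot>\<^bsub>C\<^esub> x \<in> carrier C"
    and closed: "\<And>x y. \<lbrakk>x \<in> carrier C; y \<in> carrier C\<rbrakk> \<Longrightarrow> x \<otimes>\<^bsub>C\<^esub> y \<in> carrier C"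
    and l_distr: "\<And>x x' y. \<lbrakk>x \<in> carrier C; x' \<in> carrier C; y \<in> carrier C\<rbrakk>
      \<Longrightarrow> (x \<oplus>\<^bsub>C\<^esub> x') \<otimes>\<^bsub>C\<^esub> y = x \<otimes>\<^bsub>C\<^esub> y \<oplus>\<^bsub>C\<^esub> x' \<otimes>\<^bsub>C\<^esub> y"
    and r_distr: "\<And>x y y'. \<lbrakk>x \<in> carrier C; y \<in> carrier C; y' \<in> carrier C\<rbrakk>
      \<Longrightarrow> x \<otimes>\<^bsub>C\<^esub> (y \<oplus>\<^bsub>C\<^esub> y') = x \<otimes>\<^bsub>C\<^esub> y \<oplus>\<^bsub>C\<^esub> x \<otimes>\<^bsub>C\<^esub> y'"
    and balanced: "\<And>a x y. \<lbrakk>a \<in> carrier K; x \<in> carrier C; y \<in> carrier C\<rbrakk>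
      \<Longrightarrow> (a \<odot>\<^bsub>C\<^esub> x) \<otimes>\<^bsub>C\<^esub> y = x \<otimes>\<^bsub>C\<^esub> (a \<odot>\<^bsub>C\<^esub> y)"
    and fin: "finite I"
    and split: "\<And>x. x \<in> carrier C \<Longrightarrow> \<exists>u v. u \<in> I \<rightarrow> carrier C \<and> v \<in> I \<rightarrow> carrier C \<and>
      x = finsum C (\<lambda>i. u i \<otimes>\<^bsub>C\<^esub> v i) I"
  shows "mult_map_surjective K C"
proof -
  interpret C: abelian_group C by fact
  let ?S = "carrier C \<times> carrier C"
  let ?F = "free_Abelian_group ?S"
  let ?N = "tensor_kernel K C C"
  interpret F: comm_group ?F by (rule abelian_free_Abelian_group)
  have of_carrier: "frag_of (x, y) \<in> carrier ?F" if "x \<in> carrier C" "y \<in> carrier C" for x y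
    using that by simp
  obtain h where h: "h \<in> hom ?F (add_monoid C)"
    and h_of: "\<And>z. z \<in> ?S \<Longrightarrow> h (frag_of z) = (\<lambda>(x, y). x \<otimes>\<^bsub>C\<^esub> y) z"
  proof (rule C.add.free_Abelian_group_universal[of "\<lambda>(x, y). x \<otimes>\<^bsub>C\<^esub> y" ?S])
    show "(\<lambda>(x, y). x \<otimes>\<^bsub>C\<^esub> y) ` ?S \<subseteq> carrier C"
      using closed by auto
  qed (rule that)
  interpret h: group_hom ?F "add_monoid C" h
    using h by (simp add: group_hom_def group_hom_axioms_def C.a_group)
  \<comment> \<open>The tensor relations are written with the subtraction of the underlying type,
    whereas \<open>h\<close> is only known to respect the group operation; writing \<open>a\<close>
    as \<open>(a - b) + b\<close> bridges the two.\<close>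
  have diff: "a - b \<in> carrier ?F \<and> h (a - b) = h a \<ominus>\<^bsub>C\<^esub> h b"
    if "a \<in> carrier ?F" "b \<in> carrier ?F" for a b
  proof -
    have c: "a - b \<in> carrier ?F"
      using that by (meson carrier_free_Abelian_group_iff keys_diff le_sup_iff order_trans)
    have "h a = h (a - b) \<oplus>\<^bsub>C\<^esub> h b"
      using h.hom_mult[OF c that(2)] by simp
    then show ?thesis
      using c that h.hom_closed
      by (simp add: C.minus_eq C.a_assoc C.r_neg)
  qed
  have hd: "h (frag_of (x, y)) = x \<otimes>\<^bsub>C\<^esub> y" "x \<otimes>\<^bsub>C\<^esub> y \<in> carrier C"
    if "x \<in> carrier C" "y \<in> carrier C" for x y
    using that h_of closed by auto
  have cancel: "(x \<oplus>\<^bsub>C\<^esub> y) \<ominus>\<^bsub>C\<^esub> x \<ominus>\<^bsub>C\<^esub> y = \<zero>\<^bsub>C\<^esub>" "x \<ominus>\<^bsub>C\<^esub> x = \<zero>\<^bsub>C\<^esub>"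
    if "x \<in> carrier C" "y \<in> carrier C" for x y
  proof -
    have "(x \<oplus>\<^bsub>C\<^esub> y) \<ominus>\<^bsub>C\<^esub> x \<ominus>\<^bsub>C\<^esub> y = (x \<oplus>\<^bsub>C\<^esub> y) \<oplus>\<^bsub>C\<^esub> (\<ominus>\<^bsub>C\<^esub> x \<oplus>\<^bsub>C\<^esub> \<ominus>\<^bsub>C\<^esub> y)"
      using that by (simp only: C.minus_eq C.a_assoc C.a_inv_closed C.a_closed)
    then show "(x \<oplus>\<^bsub>C\<^esub> y) \<ominus>\<^bsub>C\<^esub> x \<ominus>\<^bsub>C\<^esub> y = \<zero>\<^bsub>C\<^esub>"
      using that by (simp only: C.minus_add[symmetric] C.r_neg C.a_closed)
    show "x \<ominus>\<^bsub>C\<^esub> x = \<zero>\<^bsub>C\<^esub>"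
      using that by (simp only: C.minus_eq C.r_neg)
  qed
  have rel_l: "frag_of (x \<oplus>\<^bsub>C\<^esub> x', y) - frag_of (x, y) - frag_of (x', y) \<in> kernel ?F (add_monoid C) h"
    if "x \<in> carrier C" "x' \<in> carrier C" "y \<in> carrier C" for x x' y
    using that diff[OF of_carrier of_carrier, of "x \<oplus>\<^bsub>C\<^esub> x'" y x y]
      diff[of "frag_of (x \<oplus>\<^bsub>C\<^esub> x', y) - frag_of (x, y)" "frag_of (x', y)"] of_carrier[of x' y]
    by (simp add: kernel_def hd l_distr cancel del: carrier_free_Abelian_group_iff)
  have rel_r: "frag_of (x, y \<oplus>\<^bsub>C\<^esub> y') - frag_of (x, y) - frag_of (x, y') \<in> kernel ?F (add_monoid C) h"
    if "x \<in> carrier C" "y \<in> carrier C" "y' \<in> carrier C" for x y y'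
    using that diff[OF of_carrier of_carrier, of x "y \<oplus>\<^bsub>C\<^esub> y'" x y]
      diff[of "frag_of (x, y \<oplus>\<^bsub>C\<^esub> y') - frag_of (x, y)" "frag_of (x, y')"] of_carrier[of x y']
    by (simp add: kernel_def hd r_distr cancel del: carrier_free_Abelian_group_iff)
  have rel_bal: "frag_of (a \<odot>\<^bsub>C\<^esub> x, y) - frag_of (x, a \<odot>\<^bsub>C\<^esub> y) \<in> kernel ?F (add_monoid C) h"
    if "a \<in> carrier K" "x \<in> carrier C" "y \<in> carrier C" for a x y
    using that diff[OF of_carrier of_carrier, of "a \<odot>\<^bsub>C\<^esub> x" y x "a \<odot>\<^bsub>C\<^esub> y"]
    by (simp add: kernel_def hd balanced smult cancel del: carrier_free_Abelian_group_iff)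
  have rel: "tensor_relations K C C \<subseteq> kernel ?F (add_monoid C) h"
    unfolding tensor_relations_def
    by (intro Un_least subsetI; elim CollectE exE conjE; hypsubst)
      ((rule rel_l rel_r rel_bal; assumption)+)
  have N: "?N \<lhd> ?F"
    unfolding tensor_kernel_def
    using rel by (intro F.subgroup_imp_normal F.generate_is_subgroup) (auto simp: kernel_def)
  have "?N \<subseteq> kernel ?F (add_monoid C) h"
    unfolding tensor_kernel_def
    by (rule F.generate_subgroup_incl[OF rel h.subgroup_kernel])
  then obtain \<mu> where \<mu>: "\<mu> \<in> hom (?F Mod ?N) (add_monoid C)"
    and \<mu>_coset: "\<And>x. x \<in> carrier ?F \<Longrightarrow> \<mu> (?N #>\<^bsub>?F\<^esub> x) = h x"
    using h.FactGroup_universal_kernel[OF N] by metis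
  interpret \<mu>: group_hom "?F Mod ?N" "add_monoid C" \<mu>
    using \<mu> normal.factorgroup_is_group[OF N]
    by (simp add: group_hom_def group_hom_axioms_def C.a_group)
  have pure: "\<mu> (pure_tensor K C C x y) = x \<otimes>\<^bsub>C\<^esub> y"
    "pure_tensor K C C x y \<in> carrier (?F Mod ?N)"
    if "x \<in> carrier C" "y \<in> carrier C" for x y
    using \<mu>_coset[of "frag_of (x, y)"] that hd
    by (auto simp: pure_tensor_def carrier_FactGroup simp del: carrier_free_Abelian_group_iff
        intro!: imageI of_carrier)
  \<comment> \<open>Pure tensors only reach single products; that the image is a subgroup is what
    brings in finite sums of products.\<close>
  have img: "subgroup (\<mu> ` carrier (?F Mod ?N)) (add_monoid C)"
    by (rule \<mu>.img_is_subgroup)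
  have sums: "finsum C F I \<in> \<mu> ` carrier (?F Mod ?N)" if "F \<in> I \<rightarrow> \<mu> ` carrier (?F Mod ?N)" for F
    using fin that
  proof (induct I rule: finite_induct)
    case empty
    show ?case using subgroup.one_closed[OF img] by simp
  next
    case (insert i I)
    have "F \<in> I \<rightarrow> carrier C" "F i \<in> carrier C"
      using insert.prems subgroup.subset[OF img] by auto
    then show ?case
      using insert subgroup.m_closed[OF img] by simp
  qed
  have "x \<in> \<mu> ` carrier (?F Mod ?N)" if x: "x \<in> carrier C" for x
  proof -
    obtain u v where uv: "u \<in> I \<rightarrow> carrier C" "v \<in> I \<rightarrow> carrier C"
      "x = finsum C (\<lambda>i. u i \<otimes>\<^bsub>C\<^esub> v i) I"
      using split[OF x] by blast
    have "(\<lambda>i. u i \<otimes>\<^bsub>C\<^esub> v i) \<in> I \<rightarrow> \<mu> ` carrier (?F Mod ?N)"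
    proof
      fix i assume "i \<in> I"
      then have "u i \<in> carrier C" "v i \<in> carrier C" using uv by auto
      then show "u i \<otimes>\<^bsub>C\<^esub> v i \<in> \<mu> ` carrier (?F Mod ?N)"
        using pure[of "u i" "v i"] by (metis imageI)
    qed
    then show ?thesis using sums uv(3) by simp
  qed
  moreover have "\<mu> ` carrier (?F Mod ?N) \<subseteq> carrier C"
    using subgroup.subset[OF img] by simp
  ultimately have "\<mu> ` carrier (?F Mod ?N) = carrier C" by blast
  then show ?thesis
    unfolding mult_map_surjective_def tensor_product_def
    using \<mu> pure(1) by blast
qed

section \<open>Homotopes\<close>

lemma ring_opposite:
  assumes "ring R"
  shows "ring (opposite R)"
proof -
  interpret ring R by fact
  show ?thesis
  proof (rule ringI)
    show "abelian_group (opposite R)"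
      by (rule abelian_groupI) (auto simp: opposite_def a_ac intro: bexI[of _ "\<ominus>\<^bsub>R\<^esub> _"] l_neg)
    show "monoid (opposite R)"
      by (rule monoidI) (auto simp: opposite_def m_assoc)
  qed (auto simp: opposite_def l_distr r_distr)
qed

lemma ideal_opposite:
  assumes "ideal I R"
  shows "ideal I (opposite R)"
proof -
  interpret ideal I R by fact
  have "subgroup I (add_monoid (opposite R))"
    using a_subgroup by (simp add: opposite_def)
  then show ?thesis
    by (rule idealI[OF ring_opposite[OF ring_axioms]])
      (auto simp: opposite_def I_l_closed I_r_closed)
qed

lemma left_module_ideal:
  assumes "ideal I R"
  shows "left_module R (ideal_module R I)"
proof -
  interpret ideal I R by fact
  have "abelian_group (ideal_module R I)"
  proof (rule abelian_groupI)
    fix x assume "x \<in> carrier (ideal_module R I)"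
    then have "x \<in> I" by (simp add: ideal_module_def)
    then have "\<ominus>\<^bsub>R\<^esub> x \<in> I" "\<ominus>\<^bsub>R\<^esub> x \<oplus>\<^bsub>R\<^esub> x = \<zero>\<^bsub>R\<^esub>"
      using a_inv_closed l_neg a_Hcarr by auto
    then show "\<exists>y\<in>carrier (ideal_module R I). y \<oplus>\<^bsub>ideal_module R I\<^esub> x = \<zero>\<^bsub>ideal_module R I\<^esub>"
      by (auto simp: ideal_module_def)
  qed (simp_all add: ideal_module_def a_ac)
  then show ?thesis
    by (intro left_module.intro ring_axioms left_module_axioms.intro)
      (auto simp: ideal_module_def I_l_closed l_distr r_distr m_assoc a_Hcarr)
qed

section \<open>The unital algebra of a homotope and its augmentation ideal\<close>

lemma carrier_adjoin_unit_homotope [simp]: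
  "carrier (adjoin_unit K (homotope A \<Delta>)) = carrier K \<times> carrier A"
  by (simp add: adjoin_unit_def homotope_def)

lemma mult_adjoin_unit_homotope [simp]:
  "(k, x) \<otimes>\<^bsub>adjoin_unit K (homotope A \<Delta>)\<^esub> (l, y) =
     (k \<otimes>\<^bsub>K\<^esub> l, k \<odot>\<^bsub>A\<^esub> y \<oplus>\<^bsub>A\<^esub> l \<odot>\<^bsub>A\<^esub> x \<oplus>\<^bsub>A\<^esub> x \<otimes>\<^bsub>A\<^esub> \<Delta> \<otimes>\<^bsub>A\<^esub> y)"
  by (simp add: adjoin_unit_def homotope_def)

lemma add_adjoin_unit_homotope [simp]:
  "(k, x) \<oplus>\<^bsub>adjoin_unit K (homotope A \<Delta>)\<^esub> (l, y) = (k \<oplus>\<^bsub>K\<^esub> l, x \<oplus>\<^bsub>A\<^esub> y)"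
  by (simp add: adjoin_unit_def homotope_def)

lemma zero_adjoin_unit_homotope [simp]:
  "\<zero>\<^bsub>adjoin_unit K (homotope A \<Delta>)\<^esub> = (\<zero>\<^bsub>K\<^esub>, \<zero>\<^bsub>A\<^esub>)"
  by (simp add: adjoin_unit_def homotope_def)

lemma one_adjoin_unit_homotope [simp]:
  "\<one>\<^bsub>adjoin_unit K (homotope A \<Delta>)\<^esub> = (\<one>\<^bsub>K\<^esub>, \<zero>\<^bsub>A\<^esub>)"
  by (simp add: adjoin_unit_def homotope_def)

lemma ring_adjoin_unit_homotope:
  assumes "assoc_algebra K A" and \<Delta>: "\<Delta> \<in> carrier A"
  shows "ring (adjoin_unit K (homotope A \<Delta>))" (is "ring ?B")
proof (rule ringI)
  interpret A: assoc_algebra K A by fact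
  show "abelian_group ?B"
  proof (rule abelian_groupI)
    fix z assume "z \<in> carrier ?B"
    then obtain k x where z: "z = (k, x)" "k \<in> carrier K" "x \<in> carrier A" by auto
    then show "\<exists>y\<in>carrier ?B. y \<oplus>\<^bsub>?B\<^esub> z = \<zero>\<^bsub>?B\<^esub>"
      by (intro bexI[of _ "(\<ominus>\<^bsub>K\<^esub> k, \<ominus>\<^bsub>A\<^esub> x)"]) (simp_all add: A.R.l_neg A.M.l_neg)
  qed (auto simp: A.R.a_ac A.M.a_ac)
  note distr = A.smult_l_distr A.smult_r_distr A.A.l_distr A.A.r_distr
  note scalars = A.smult_mult_left A.smult_mult_right A.smult_assoc1[symmetric]
  show "monoid ?B"
  proof (rule monoidI)
    \<comment> \<open>For triples (k,x), (l,y), (m,z) both bracketings have the second component klz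
      + kmy + lmx + m(x\<Delta>y) + l(x\<Delta>z) + k(y\<Delta>z) + x\<Delta>y\<Delta>z.\<close>
    fix x y z assume "x \<in> carrier ?B" "y \<in> carrier ?B" "z \<in> carrier ?B"
    then show "x \<otimes>\<^bsub>?B\<^esub> y \<otimes>\<^bsub>?B\<^esub> z = x \<otimes>\<^bsub>?B\<^esub> (y \<otimes>\<^bsub>?B\<^esub> z)"
      using \<Delta> by (auto simp: distr scalars A.R.m_ac A.A.m_assoc A.M.a_ac)
  qed (use \<Delta> in auto)
  show "(x \<oplus>\<^bsub>?B\<^esub> y) \<otimes>\<^bsub>?B\<^esub> z = x \<otimes>\<^bsub>?B\<^esub> z \<oplus>\<^bsub>?B\<^esub> y \<otimes>\<^bsub>?B\<^esub> z"
    if "x \<in> carrier ?B" "y \<in> carrier ?B" "z \<in> carrier ?B" for x y z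
    using that \<Delta> by (auto simp: distr A.R.l_distr A.M.a_ac)
  show "z \<otimes>\<^bsub>?B\<^esub> (x \<oplus>\<^bsub>?B\<^esub> y) = z \<otimes>\<^bsub>?B\<^esub> x \<oplus>\<^bsub>?B\<^esub> z \<otimes>\<^bsub>?B\<^esub> y"
    if "x \<in> carrier ?B" "y \<in> carrier ?B" "z \<in> carrier ?B" for x y z
    using that \<Delta> by (auto simp: distr A.R.r_distr A.M.a_ac)
qed

text \<open>This is the kernel of the projection onto the scalar component, which is additive and
  multiplicative.\<close>

lemma ideal_augmentation_ideal_homotope:
  assumes "assoc_algebra K A" and \<Delta>: "\<Delta> \<in> carrier A"
  shows "ideal (augmentation_ideal K (homotope A \<Delta>)) (adjoin_unit K (homotope A \<Delta>))"
    (is "ideal ?I ?B")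
proof -
  interpret A: assoc_algebra K A by fact
  interpret B: ring ?B using assms by (rule ring_adjoin_unit_homotope)
  have I: "?I = {\<zero>\<^bsub>K\<^esub>} \<times> carrier A"
    by (simp add: augmentation_ideal_def homotope_def)
  have "subgroup ?I (add_monoid ?B)"
  proof (rule B.add.subgroupI)
    fix z assume "z \<in> ?I"
    then obtain x where z: "z = (\<zero>\<^bsub>K\<^esub>, x)" "x \<in> carrier A" by (auto simp: I)
    then have "\<ominus>\<^bsub>?B\<^esub> z = (\<zero>\<^bsub>K\<^esub>, \<ominus>\<^bsub>A\<^esub> x)"
      by (intro B.minus_equality) (simp_all add: A.M.l_neg)
    then show "\<ominus>\<^bsub>?B\<^esub> z \<in> ?I" using z by (simp add: I)
  qed (auto simp: I)
  then show ?thesis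
    by (rule idealI[OF B.ring_axioms]) (use \<Delta> in \<open>auto simp: I\<close>)
qed

text \<open>The embedding of \<open>A\<close> as the pairs with zero scalar part is additive. The
  ring \<open>R\<close> is kept general so that one statement covers the unital algebra and its
  opposite, which have the same addition.\<close>

lemma finsum_ideal_module_Pair:
  fixes K :: "('k, 'c) ring_scheme" and A :: "('a, 'd) ring_scheme" and R :: "('k \<times> 'a, 'e) ring_scheme"
  defines "P \<equiv> ideal_module R ({\<zero>\<^bsub>K\<^esub>} \<times> carrier A)"
  assumes P: "left_module R P"
    and K: "cring K" and A: "abelian_group A" and F: "F \<in> I \<rightarrow> carrier A"
    and add: "\<And>x y. (\<zero>\<^bsub>K\<^esub>, x) \<oplus>\<^bsub>R\<^esub> (\<zero>\<^bsub>K\<^esub>, y) = (\<zero>\<^bsub>K\<^esub> \<oplus>\<^bsub>K\<^esub> \<zero>\<^bsub>K\<^esub>, x \<oplus>\<^bsub>A\<^esub> y)"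
  shows "finsum P (\<lambda>i. (\<zero>\<^bsub>K\<^esub>, F i)) I = (\<zero>\<^bsub>K\<^esub>, finsum A F I)"
proof -
  interpret K: cring K by fact
  show ?thesis
    using P add
    by (intro additive_hom_finsum[OF A _ _ _ F, of P "Pair \<zero>\<^bsub>K\<^esub>", symmetric])
      (auto simp: left_module_def P_def ideal_module_def)
qed

text \<open>Separates the module theory from the graph: splitting \<open>x\<close> along the family
  \<open>e\<close> and replacing each \<open>e i\<close> by
  \<open>e i \<otimes> \<Delta> \<otimes> e i\<close> turns \<open>x\<close> into a sum of homotope
  products, and the same computation yields a dual basis on either side.\<close>

lemma well_temperedI:
  fixes K :: "('k, 'c) ring_scheme" and A :: "('k, 'a) module"
  assumes alg: "assoc_algebra K A" and \<Delta>: "\<Delta> \<in> carrier A"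
    and fin: "finite I" and e: "\<And>i. i \<in> I \<Longrightarrow> e i \<in> carrier A"
    and e_\<Delta>_e: "\<And>i. i \<in> I \<Longrightarrow> e i \<otimes>\<^bsub>A\<^esub> \<Delta> \<otimes>\<^bsub>A\<^esub> e i = e i"
    and sum_e: "finsum A e I = \<one>\<^bsub>A\<^esub>"
  shows "well_tempered TYPE('m) TYPE('n) K A \<Delta>"
proof -
  interpret A: assoc_algebra K A by fact
  let ?C = "homotope A \<Delta>"
  let ?B = "adjoin_unit K ?C"
  let ?J = "augmentation_ideal K ?C"
  let ?o = "\<zero>\<^bsub>K\<^esub>"
  have J: "?J = {?o} \<times> carrier A"
    by (simp add: augmentation_ideal_def homotope_def)
  interpret B: ring ?B using alg \<Delta> by (rule ring_adjoin_unit_homotope)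
  have ideal: "ideal ?J ?B" using alg \<Delta> by (rule ideal_augmentation_ideal_homotope)
  have ePi: "e \<in> I \<rightarrow> carrier A" using e by blast
  have sum_r: "finsum A (\<lambda>i. x \<otimes>\<^bsub>A\<^esub> e i) I = x" if "x \<in> carrier A" for x
    using A.A.finsum_rdistr[OF fin that ePi] sum_e that by simp
  have sum_l: "finsum A (\<lambda>i. e i \<otimes>\<^bsub>A\<^esub> x) I = x" if "x \<in> carrier A" for x
    using A.A.finsum_ldistr[OF fin that ePi] sum_e that by simp
  have absorb_r: "x \<otimes>\<^bsub>A\<^esub> e i \<otimes>\<^bsub>A\<^esub> \<Delta> \<otimes>\<^bsub>A\<^esub> e i = x \<otimes>\<^bsub>A\<^esub> e i"
    if "x \<in> carrier A" "i \<in> I" for x i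
    using e_\<Delta>_e[OF that(2)] that e \<Delta> by (simp add: A.A.m_assoc)
  have absorb_l: "e i \<otimes>\<^bsub>A\<^esub> \<Delta> \<otimes>\<^bsub>A\<^esub> (e i \<otimes>\<^bsub>A\<^esub> x) = e i \<otimes>\<^bsub>A\<^esub> x"
    if "x \<in> carrier A" "i \<in> I" for x i
    using e_\<Delta>_e[OF that(2)] that e \<Delta> by (metis A.A.m_assoc A.A.m_closed)
  have surj: "mult_map_surjective K ?C"
  proof (rule mult_map_surjectiveI[OF _ _ _ _ _ _ fin])
    show "abelian_group ?C"
      using A.M.abelian_group_axioms
      by (simp add: homotope_def abelian_group_def abelian_monoid_def abelian_group_axioms_def)
  next
    fix x assume "x \<in> carrier ?C"
    then have x: "x \<in> carrier A" by (simp add: homotope_def)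
    have "x = finsum A (\<lambda>i. x \<otimes>\<^bsub>A\<^esub> e i \<otimes>\<^bsub>A\<^esub> \<Delta> \<otimes>\<^bsub>A\<^esub> e i) I"
      using sum_r[OF x] absorb_r[OF x] x e
      by (metis (no_types, lifting) A.A.m_closed A.M.finsum_cong' Pi_I)
    \<comment> \<open>The homotope differs from \<open>A\<close> only in its multiplication, so the
      two finite sums coincide once \<open>finsum\<close> is unfolded.\<close>
    then show "\<exists>u v. u \<in> I \<rightarrow> carrier ?C \<and> v \<in> I \<rightarrow> carrier ?C \<and>
        x = finsum ?C (\<lambda>i. u i \<otimes>\<^bsub>?C\<^esub> v i) I"
      using x e
      by (intro exI[of _ "\<lambda>i. x \<otimes>\<^bsub>A\<^esub> e i"] exI[of _ e])
        (simp add: homotope_def finsum_def)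
  qed (use \<Delta> in \<open>auto simp: homotope_def A.A.l_distr A.A.r_distr A.smult_mult_left A.smult_mult_right\<close>)
  have left: "projective TYPE('m) TYPE('n) ?B (ideal_module ?B ?J)"
  proof (rule projective_dual_basis[OF left_module_ideal[OF ideal] fin])
    \<comment> \<open>With zero scalar parts the product of \<open>(?o, x \<otimes> e i)\<close> and
      \<open>(?o, e i)\<close> is
      \<open>(?o, x \<otimes> e i \<otimes> \<Delta> \<otimes> e i)\<close>, which
      \<open>absorb_r\<close> reduces to the i-th part of \<open>x\<close>.\<close>
    let ?\<phi> = "\<lambda>i (k, x). (?o, x \<otimes>\<^bsub>A\<^esub> e i)"
    show "(\<lambda>i. (?o, e i)) \<in> I \<rightarrow> carrier (ideal_module ?B ?J)"
      using e by (simp add: ideal_module_def J)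
    \<comment> \<open>A pair (k,y) acts on the ideal by x \<mapsto> kx + y\<Delta>x, and this
      commutes with right multiplication by \<open>e i\<close> in \<open>A\<close>.\<close>
    show "?\<phi> i \<in> left_module_hom ?B (ideal_module ?B ?J) (ideal_module ?B (carrier ?B))" if "i \<in> I" for i
      using e[OF that] \<Delta>
      by (auto simp: left_module_hom_def ideal_module_def J A.A.l_distr A.A.m_assoc A.smult_mult_left)
    fix z assume "z \<in> carrier (ideal_module ?B ?J)"
    then obtain x where z: "z = (?o, x)" and x: "x \<in> carrier A"
      by (auto simp: ideal_module_def J)
    have "finsum (ideal_module ?B ?J) (\<lambda>i. ?\<phi> i z \<odot>\<^bsub>ideal_module ?B ?J\<^esub> (?o, e i)) I =
        finsum (ideal_module ?B ?J) (\<lambda>i. (?o, x \<otimes>\<^bsub>A\<^esub> e i)) I"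
      using left_module_ideal[OF ideal] x e \<Delta>
      by (intro abelian_monoid.finsum_cong')
        (auto simp: left_module_def abelian_group_def ideal_module_def J z absorb_r)
    also have "\<dots> = z"
      using left_module_ideal[OF ideal] finsum_ideal_module_Pair[of ?B K A "\<lambda>i. x \<otimes>\<^bsub>A\<^esub> e i" I]
        x e sum_r A.R.cring_axioms A.M.abelian_group_axioms by (simp add: J z)
    finally show "z = finsum (ideal_module ?B ?J) (\<lambda>i. ?\<phi> i z \<odot>\<^bsub>ideal_module ?B ?J\<^esub> (?o, e i)) I"
      by simp
  qed
  let ?B' = "opposite ?B"
  have ideal': "ideal ?J ?B'" using ideal by (rule ideal_opposite)
  have B': "carrier ?B' = carrier ?B" "\<And>u v. u \<otimes>\<^bsub>?B'\<^esub> v = v \<otimes>\<^bsub>?B\<^esub> u" "add ?B' = add ?B"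
    by (simp_all add: opposite_def)
  have right: "projective TYPE('m) TYPE('n) ?B' (ideal_module ?B' ?J)"
  proof (rule projective_dual_basis[OF left_module_ideal[OF ideal'] fin])
    \<comment> \<open>The opposite multiplication exchanges the factors:
      \<open>(?o, e i \<otimes> x)\<close> acting on \<open>(?o, e i)\<close> gives
      \<open>(?o, e i \<otimes> \<Delta> \<otimes> (e i \<otimes> x))\<close>, so the coordinate
      maps must now multiply on the left.\<close>
    let ?\<phi> = "\<lambda>i (k, x). (?o, e i \<otimes>\<^bsub>A\<^esub> x)"
    show "(\<lambda>i. (?o, e i)) \<in> I \<rightarrow> carrier (ideal_module ?B' ?J)"
      using e by (simp add: ideal_module_def J)
    show "?\<phi> i \<in> left_module_hom ?B' (ideal_module ?B' ?J) (ideal_module ?B' (carrier ?B'))" if "i \<in> I" for i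
      using e[OF that] \<Delta>
      by (auto simp: left_module_hom_def ideal_module_def J B' A.A.r_distr A.A.m_assoc A.smult_mult_right)
    fix z assume "z \<in> carrier (ideal_module ?B' ?J)"
    then obtain x where z: "z = (?o, x)" and x: "x \<in> carrier A"
      by (auto simp: ideal_module_def J)
    have "finsum (ideal_module ?B' ?J) (\<lambda>i. ?\<phi> i z \<odot>\<^bsub>ideal_module ?B' ?J\<^esub> (?o, e i)) I =
        finsum (ideal_module ?B' ?J) (\<lambda>i. (?o, e i \<otimes>\<^bsub>A\<^esub> x)) I"
      using left_module_ideal[OF ideal'] x e \<Delta>
      by (intro abelian_monoid.finsum_cong')
        (auto simp: left_module_def abelian_group_def ideal_module_def J B' z absorb_l)
    also have "\<dots> = z"
      using left_module_ideal[OF ideal'] finsum_ideal_module_Pair[of ?B' K A "\<lambda>i. e i \<otimes>\<^bsub>A\<^esub> x" I]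
        x e sum_l A.R.cring_axioms A.M.abelian_group_axioms by (simp add: J z B')
    finally show "z = finsum (ideal_module ?B' ?J) (\<lambda>i. ?\<phi> i z \<odot>\<^bsub>ideal_module ?B' ?J\<^esub> (?o, e i)) I"
      by simp
  qed
  show ?thesis
    unfolding well_tempered_def Let_def using alg \<Delta> surj left right by blast
qed

section \<open>Composition of homotopy classes\<close>

lemma backtrack_endpoints: "backtrack G x y \<Longrightarrow> fst x = fst y \<and> snd (snd x) = snd (snd y)"
  by (auto elim: backtrack.cases)

lemma equivclp_backtrack_endpoints:
  "equivclp (backtrack G) x y \<Longrightarrow> fst x = fst y \<and> snd (snd x) = snd (snd y)"
  by (induct rule: equivclp_induct) (auto dest: backtrack_endpoints)

lemma equiv_homotopy: "equiv (paths G) (homotopy G)"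
proof (rule equivI)
  show "homotopy G \<subseteq> paths G \<times> paths G" by (auto simp: homotopy_def)
  show "refl_on (paths G) (homotopy G)" by (auto simp: refl_on_def homotopy_def)
  show "sym (homotopy G)" by (auto simp: sym_def homotopy_def intro: equivclp_sym)
  show "trans (homotopy G)" by (auto simp: trans_def homotopy_def intro: equivclp_trans)
qed

text \<open>Deleting or inserting a backtrack leaves the stored endpoints alone. They are part of
  the path because an empty list of edges does not determine its vertex.\<close>

lemma homotopy_endpoints:
  "((u, p, v), (u', p', v')) \<in> homotopy G \<Longrightarrow> u = u' \<and> v = v'"
  by (auto simp: homotopy_def dest: equivclp_backtrack_endpoints)

lemma hclass_eq_iff:
  "x \<in> paths G \<Longrightarrow> y \<in> paths G \<Longrightarrow> hclass G x = hclass G y \<longleftrightarrow> (x, y) \<in> homotopy G"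
  unfolding hclass_def by (rule eq_equiv_class_iff[OF equiv_homotopy])

lemma hclass_endpoints:
  "(u, p, v) \<in> paths G \<Longrightarrow> (u', p', v') \<in> paths G \<Longrightarrow>
   hclass G (u, p, v) = hclass G (u', p', v') \<Longrightarrow> u = u' \<and> v = v'"
  by (auto simp: hclass_eq_iff dest: homotopy_endpoints)

lemma poincare_classes_eq: "poincare_classes G = hclass G ` paths G"
  by (auto simp: poincare_classes_def hclass_def quotient_def)

text \<open>Makes \<open>{}\<close> usable as the mark of an undefined concatenation: every basis
  coefficient vanishes there.\<close>

lemma empty_notin_poincare_classes: "{} \<notin> poincare_classes G"
  unfolding poincare_classes_def using in_quotient_imp_non_empty[OF equiv_homotopy] by blast

lemma poincare_classes_cases:
  assumes "c \<in> poincare_classes G"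
  obtains u p v where "(u, p, v) \<in> paths G" "c = hclass G (u, p, v)"
  using assms by (auto simp: poincare_classes_eq)

text \<open>The mark \<open>{}\<close> is absorbing, which makes concatenation a total operation,
  associative without any condition on composability.\<close>

lemma hconcat_empty [simp]: "hconcat G {} d = {}" "hconcat G c {} = {}"
  by (simp_all add: hconcat_def)

section \<open>Concatenation is well defined on homotopy classes\<close>

context pair_wf_digraph
begin

lemma paths_Nil_iff: "(u, [], v) \<in> paths G \<longleftrightarrow> u = v \<and> u \<in> pverts G"
  by (simp add: paths_def awalk_Nil_iff)

lemma paths_arc: "(i, j) \<in> parcs G \<Longrightarrow> (i, [(i, j)], j) \<in> paths G"
  by (auto simp: paths_def awalk_Cons_iff awalk_Nil_iff dest: in_arcsD2)

lemma paths_append: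
  "(u, p, v) \<in> paths G \<Longrightarrow> (v, q, w) \<in> paths G \<Longrightarrow> (u, p @ q, w) \<in> paths G"
  unfolding paths_def using awalk_appendI by blast

lemma paths_endpoints: "(u, p, v) \<in> paths G \<Longrightarrow> u \<in> pverts G \<and> v \<in> pverts G"
  by (auto simp: paths_def dest: awalk_hd_in_verts awalk_last_in_verts)

text \<open>The appended path joins the part behind the backtrack. Projections replace explicit
  triples so that the lemma applies to the opaque intermediate paths of an \<open>equivclp\<close>
  induction.\<close>

lemma backtrack_append_right:
  assumes "backtrack G x y" "(snd (snd x), q, w) \<in> paths G"
  shows "backtrack G (fst x, fst (snd x) @ q, w) (fst y, fst (snd y) @ q, w)"
  using assms(1)
proof cases
  case (1 u p a b r v)
  have "(u, p @ (a, b) # (b, a) # r @ q, w) \<in> paths G"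
    using paths_append[of u "p @ (a, b) # (b, a) # r" v q w] 1 assms(2) by simp
  then show ?thesis using backtrack.intros[of u p a b "r @ q" w G] 1 by simp
qed

lemma backtrack_append_left:
  assumes "backtrack G x y" "(t, q, fst x) \<in> paths G"
  shows "backtrack G (t, q @ fst (snd x), snd (snd x)) (t, q @ fst (snd y), snd (snd y))"
  using assms(1)
proof cases
  case (1 u p a b r v)
  have "(t, (q @ p) @ (a, b) # (b, a) # r, v) \<in> paths G"
    using paths_append[of t q u "p @ (a, b) # (b, a) # r" v] 1 assms(2) by simp
  then show ?thesis using backtrack.intros[of t "q @ p" a b r v G] 1 by simp
qed

text \<open>The two factors are deformed one after the other: from \<open>p\<close> to
  \<open>p'\<close> with \<open>q\<close> attached, and from \<open>q\<close> to \<open>q'\<close>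
  behind \<open>p'\<close>.\<close>

lemma homotopy_append:
  assumes p: "((u, p, v), (u, p', v)) \<in> homotopy G" and q: "((v, q, w), (v, q', w)) \<in> homotopy G"
  shows "((u, p @ q, w), (u, p' @ q', w)) \<in> homotopy G"
proof -
  have paths: "(u, p, v) \<in> paths G" "(u, p', v) \<in> paths G" "(v, q, w) \<in> paths G" "(v, q', w) \<in> paths G"
    using p q by (auto simp: homotopy_def)
  have right: "equivclp (backtrack G) (fst x, fst (snd x) @ r, z) (fst y, fst (snd y) @ r, z)"
    if "equivclp (backtrack G) x y" "(snd (snd x), r, z) \<in> paths G" for x y r z
    using that
  proof (induct rule: equivclp_induct)
    case (step y y')
    \<comment> \<open>Every path along the chain keeps the endpoints of \<open>x\<close>, so
      \<open>r\<close> can be attached to each of them.\<close>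
    have "(snd (snd y), r, z) \<in> paths G" "(snd (snd y'), r, z) \<in> paths G"
      using step equivclp_backtrack_endpoints[OF step(1)] backtrack_endpoints by metis+
    then have "equivclp (backtrack G) (fst y, fst (snd y) @ r, z) (fst y', fst (snd y') @ r, z)"
      using step(2) backtrack_append_right by (meson r_into_equivclp converse_r_into_equivclp)
    then show ?case using step by (meson equivclp_trans)
  qed simp
  have left: "equivclp (backtrack G) (t, r @ fst (snd x), snd (snd x)) (t, r @ fst (snd y), snd (snd y))"
    if "equivclp (backtrack G) x y" "(t, r, fst x) \<in> paths G" for x y r t
    using that
  proof (induct rule: equivclp_induct)
    case (step y y')
    have "(t, r, fst y) \<in> paths G" "(t, r, fst y') \<in> paths G"
      using step equivclp_backtrack_endpoints[OF step(1)] backtrack_endpoints by metis+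
    then have "equivclp (backtrack G) (t, r @ fst (snd y), snd (snd y)) (t, r @ fst (snd y'), snd (snd y'))"
      using step(2) backtrack_append_left by (meson r_into_equivclp converse_r_into_equivclp)
    then show ?case using step by (meson equivclp_trans)
  qed simp
  have "equivclp (backtrack G) (u, p @ q, w) (u, p' @ q, w)"
    using right[of "(u, p, v)" "(u, p', v)" q w] p paths by (simp add: homotopy_def)
  moreover have "equivclp (backtrack G) (u, p' @ q, w) (u, p' @ q', w)"
    using left[of "(v, q, w)" "(v, q', w)" u p'] q paths by (simp add: homotopy_def)
  ultimately show ?thesis
    using paths paths_append unfolding homotopy_def by (blast intro: equivclp_trans)
qed

text \<open>All concatenations of representatives are homotopic, by \<open>homotopy_append\<close>;
  and representatives can be joined at all only if the given paths can, since endpoints are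
  invariants.\<close>

lemma hconcat_hclass:
  assumes p: "(u, p, v) \<in> paths G" and q: "(v', q, w) \<in> paths G"
  shows "hconcat G (hclass G (u, p, v)) (hclass G (v', q, w)) =
    (if v = v' then hclass G (u, p @ q, w) else {})"
proof -
  define S where "S = {(u', p' @ q', w') | u' p' v'' q' w'.
      (u', p', v'') \<in> hclass G (u, p, v) \<and> (v'', q', w') \<in> hclass G (v', q, w)}"
  have eq: "hconcat G (hclass G (u, p, v)) (hclass G (v', q, w)) = homotopy G `` S"
    by (simp only: hconcat_def S_def)
  show ?thesis
  proof (cases "v = v'")
    case False
    then have "S = {}"
      by (auto simp: S_def hclass_def dest!: homotopy_endpoints)
    then show ?thesis using False eq by simp
  next
    case True
    have refl: "(x, x) \<in> homotopy G" if "x \<in> paths G" for x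
      using that by (simp add: homotopy_def)
    have "((u, p @ q, w), z) \<in> homotopy G" if "z \<in> S" for z
    proof -
      from that obtain u' p' v'' q' w' where z: "z = (u', p' @ q', w')"
        "((u, p, v), (u', p', v'')) \<in> homotopy G" "((v', q, w), (v'', q', w')) \<in> homotopy G"
        by (auto simp: S_def hclass_def)
      with True homotopy_endpoints[OF z(2)] homotopy_endpoints[OF z(3)] homotopy_append
      show ?thesis by simp
    qed
    then have same: "homotopy G `` {z} = hclass G (u, p @ q, w)" if "z \<in> S" for z
      unfolding hclass_def using that equiv_class_eq[OF equiv_homotopy] by metis
    have "(u, p @ q, w) \<in> S"
      using refl[OF p] refl[OF q] True unfolding S_def hclass_def by blast
    \<comment> \<open>The image of \<open>S\<close> is a union of copies of a single class; that
      \<open>S\<close> is nonempty excludes the empty union.\<close>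
    moreover have "homotopy G `` S = (\<Union>z\<in>S. hclass G (u, p @ q, w))"
      using same by (subst Image_eq_UN) (rule SUP_cong[OF HOL.refl])
    ultimately have "homotopy G `` S = hclass G (u, p @ q, w)"
      by blast
    then show ?thesis using True eq by simp
  qed
qed

lemma hconcat_closed:
  assumes "c \<in> poincare_classes G" "d \<in> poincare_classes G" "hconcat G c d \<noteq> {}"
  shows "hconcat G c d \<in> poincare_classes G"
  using assms
  by (elim poincare_classes_cases)
    (auto simp: hconcat_hclass poincare_classes_eq paths_append split: if_splits)

lemma hconcat_assoc:
  assumes "c \<in> poincare_classes G" "d \<in> poincare_classes G" "e \<in> poincare_classes G"
  shows "hconcat G (hconcat G c d) e = hconcat G c (hconcat G d e)"
  using assms
  by (elim poincare_classes_cases) (auto simp: hconcat_hclass paths_append)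

end

section \<open>The algebra of the Poincare groupoid\<close>

lemma (in abelian_monoid) finsum_swap:
  assumes "finite S" "\<And>c d. c \<in> S \<Longrightarrow> d \<in> T \<Longrightarrow> F c d \<in> carrier G"
  shows "(\<Oplus>c\<in>S. \<Oplus>d\<in>T. F c d) = (\<Oplus>d\<in>T. \<Oplus>c\<in>S. F c d)"
  using assms
proof (induct S rule: finite_induct)
  case (insert c S)
  have "(\<Oplus>c'\<in>insert c S. \<Oplus>d\<in>T. F c' d) = (\<Oplus>d\<in>T. F c d) \<oplus> (\<Oplus>d\<in>T. \<Oplus>c'\<in>S. F c' d)"
    using insert by (subst finsum_insert) (auto intro!: finsum_closed)
  also have "\<dots> = (\<Oplus>d\<in>T. F c d \<oplus> (\<Oplus>c'\<in>S. F c' d))"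
    using insert by (intro finsum_addf[symmetric]) (auto intro!: finsum_closed)
  also have "\<dots> = (\<Oplus>d\<in>T. \<Oplus>c'\<in>insert c S. F c' d)"
    using insert by (intro finsum_cong') (auto intro!: finsum_closed)
  finally show ?case .
qed simp

lemma (in abelian_monoid) finsum_Times:
  assumes "finite S" "finite T" "\<And>c d. c \<in> S \<Longrightarrow> d \<in> T \<Longrightarrow> F c d \<in> carrier G"
  shows "finsum G (\<lambda>(c, d). F c d) (S \<times> T) = (\<Oplus>c\<in>S. \<Oplus>d\<in>T. F c d)"
  using assms(1,3)
proof (induct S rule: finite_induct)
  case (insert c S)
  have un: "insert c S \<times> T = Pair c ` T \<union> S \<times> T" by auto
  have "finsum G (\<lambda>(c, d). F c d) (insert c S \<times> T) = finsum G (\<lambda>(c, d). F c d) (Pair c ` T) \<oplus> finsum G (\<lambda>(c, d). F c d) (S \<times> T)"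
    unfolding un using insert assms(2) by (intro finsum_Un_disjoint) auto
  also have "finsum G (\<lambda>(c, d). F c d) (Pair c ` T) = (\<Oplus>d\<in>T. F c d)"
    using insert by (subst finsum_reindex) (auto simp: inj_on_def)
  also have "finsum G (\<lambda>(c, d). F c d) (S \<times> T) = (\<Oplus>c\<in>S. \<Oplus>d\<in>T. F c d)"
    using insert by auto
  finally show ?case
    using insert by (subst finsum_insert) (auto intro!: finsum_closed)
qed simp

section \<open>Coefficients, supports and the convolution product\<close>

locale poincare_groupoid = cring K + G: pair_graph G
  for K :: "('k, 'c) ring_scheme" (structure) and G :: "'v pair_pre_digraph"
begin

abbreviation "A \<equiv> poincare_algebra K G"
abbreviation "C \<equiv> poincare_classes G"
abbreviation "cat \<equiv> hconcat G"
abbreviation "\<delta> \<equiv> basis_elt K"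

lemma carrier_iff:
  "f \<in> carrier A \<longleftrightarrow> (\<forall>x. f x \<in> carrier K) \<and> (\<forall>x. x \<notin> C \<longrightarrow> f x = \<zero>) \<and> finite {x. f x \<noteq> \<zero>}"
  by (simp add: poincare_algebra_def)

lemma add_apply: "(f \<oplus>\<^bsub>A\<^esub> g) x = f x \<oplus> g x"
  and zero_apply: "\<zero>\<^bsub>A\<^esub> x = \<zero>"
  and smult_apply: "(a \<odot>\<^bsub>A\<^esub> f) x = a \<otimes> f x"
  by (simp_all add: poincare_algebra_def)

lemma one_apply: "\<one>\<^bsub>A\<^esub> x = (if x \<in> (\<lambda>i. hclass G (i, [], i)) ` pverts G then \<one> else \<zero>)"
  by (simp add: poincare_algebra_def)

lemma mult_apply_outside: "x \<notin> C \<Longrightarrow> (f \<otimes>\<^bsub>A\<^esub> g) x = \<zero>"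
  by (simp add: poincare_algebra_def)

lemma mult_apply_support: "x \<in> C \<Longrightarrow> (f \<otimes>\<^bsub>A\<^esub> g) x =
    finsum K (\<lambda>(c, d). f c \<otimes> g d) {(c, d). f c \<noteq> \<zero> \<and> g d \<noteq> \<zero> \<and> cat c d = x}"
  by (simp add: poincare_algebra_def)

lemma coeff_closed [simp]: "f \<in> carrier A \<Longrightarrow> f x \<in> carrier K"
  by (simp add: carrier_iff)

lemma coeff_zero: "f \<in> carrier A \<Longrightarrow> x \<notin> C \<Longrightarrow> f x = \<zero>"
  by (simp add: carrier_iff)

lemma finite_support: "f \<in> carrier A \<Longrightarrow> finite {x. f x \<noteq> \<zero>}"
  by (simp add: carrier_iff)

lemma support_subset: "f \<in> carrier A \<Longrightarrow> {x. f x \<noteq> \<zero>} \<subseteq> C"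
  using coeff_zero[of f] by auto

lemma carrierI:
  assumes "\<And>x. f x \<in> carrier K" "\<And>x. x \<notin> S \<Longrightarrow> f x = \<zero>" "finite S" "S \<subseteq> C"
  shows "f \<in> carrier A"
proof -
  have sub: "{x. f x \<noteq> \<zero>} \<subseteq> S" using assms(2) by auto
  show ?thesis
    unfolding carrier_iff
  proof (intro conjI allI impI)
    show "f x \<in> carrier K" for x by (rule assms(1))
    show "f x = \<zero>" if "x \<notin> C" for x using that assms(2,4) by auto
    show "finite {x. f x \<noteq> \<zero>}" using sub assms(3) by (rule finite_subset)
  qed
qed

lemma \<delta>_closed [simp]: "\<delta> c x \<in> carrier K"
  by (simp add: basis_elt_def)

lemma \<delta>_in_carrier: "c \<in> C \<Longrightarrow> \<delta> c \<in> carrier A"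
  by (rule carrierI[of _ "{c}"]) (auto simp: basis_elt_def)

text \<open>The condition \<open>cat c d = x\<close> moves from the index set into the Kronecker
  factor \<open>\<delta> x (cat c d)\<close>. The remaining rectangle does not depend on
  \<open>x\<close> and may exceed the supports, so several products can be summed over one index set
  and sums can be interchanged.\<close>

lemma mult_apply:
  assumes f: "f \<in> carrier A" and g: "g \<in> carrier A" and x: "x \<in> C"
    and S: "finite S" "{c. f c \<noteq> \<zero>} \<subseteq> S" and T: "finite T" "{d. g d \<noteq> \<zero>} \<subseteq> T"
  shows "(f \<otimes>\<^bsub>A\<^esub> g) x = (\<Oplus>c\<in>S. \<Oplus>d\<in>T. f c \<otimes> g d \<otimes> \<delta> x (cat c d))"
proof -
  let ?Z = "{(c, d). f c \<noteq> \<zero> \<and> g d \<noteq> \<zero> \<and> cat c d = x}"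
  have "(f \<otimes>\<^bsub>A\<^esub> g) x = finsum K (\<lambda>(c, d). f c \<otimes> g d) ?Z"
    using x by (rule mult_apply_support)
  also have "\<dots> = finsum K (\<lambda>(c, d). f c \<otimes> g d \<otimes> \<delta> x (cat c d)) (S \<times> T)"
  proof (rule add.finprod_mono_neutral_cong_left)
    show "finite (S \<times> T)" "?Z \<subseteq> S \<times> T" using S T by auto
    fix z assume "z \<in> S \<times> T - ?Z"
    then have "f (fst z) = \<zero> \<or> g (snd z) = \<zero> \<or> cat (fst z) (snd z) \<noteq> x" by auto
    then show "(case z of (c, d) \<Rightarrow> f c \<otimes> g d \<otimes> \<delta> x (cat c d)) = \<zero>"
      using f g by (auto simp: case_prod_beta basis_elt_def)
  next
    fix z assume "z \<in> ?Z"
    then show "(case z of (c, d) \<Rightarrow> f c \<otimes> g d) = (case z of (c, d) \<Rightarrow> f c \<otimes> g d \<otimes> \<delta> x (cat c d))"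
      using f g by (auto simp: basis_elt_def)
  qed (use f g in auto)
  also have "\<dots> = (\<Oplus>c\<in>S. \<Oplus>d\<in>T. f c \<otimes> g d \<otimes> \<delta> x (cat c d))"
    using f g by (intro finsum_Times S T) auto
  finally show ?thesis .
qed

text \<open>The intersection with \<open>C\<close> removes the value \<open>{}\<close> that pairs
  without a concatenation contribute.\<close>

lemma mult_support:
  assumes f: "f \<in> carrier A" and g: "g \<in> carrier A"
    and S: "finite S" "{c. f c \<noteq> \<zero>} \<subseteq> S" and T: "finite T" "{d. g d \<noteq> \<zero>} \<subseteq> T"
  shows "{x. (f \<otimes>\<^bsub>A\<^esub> g) x \<noteq> \<zero>} \<subseteq> case_prod cat ` (S \<times> T) \<inter> C" (is "_ \<subseteq> ?E")
proof -
  have "(f \<otimes>\<^bsub>A\<^esub> g) x = \<zero>" if x: "x \<notin> ?E" for x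
  proof (cases "x \<in> C")
    case True
    then have "\<delta> x (cat c d) = \<zero>" if "c \<in> S" "d \<in> T" for c d
      using x that by (auto simp: basis_elt_def)
    then show ?thesis
      unfolding mult_apply[OF f g True S T]
      using f g by (intro add.finprod_one_eqI) auto
  qed (simp add: mult_apply_outside)
  then show ?thesis by (metis (mono_tags, lifting) mem_Collect_eq subsetI)
qed

lemma mult_closed:
  assumes f: "f \<in> carrier A" and g: "g \<in> carrier A"
  shows "f \<otimes>\<^bsub>A\<^esub> g \<in> carrier A"
proof (rule carrierI)
  let ?S = "{c. f c \<noteq> \<zero>}" and ?T = "{d. g d \<noteq> \<zero>}"
  show "(f \<otimes>\<^bsub>A\<^esub> g) x \<in> carrier K" for x
  proof (cases "x \<in> C")
    case True
    show ?thesis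
      unfolding mult_apply[OF f g True finite_support[OF f] order_refl finite_support[OF g] order_refl]
      using f g by (auto intro!: finsum_closed)
  qed (simp add: mult_apply_outside)
  show "(f \<otimes>\<^bsub>A\<^esub> g) x = \<zero>" if "x \<notin> case_prod cat ` (?S \<times> ?T) \<inter> C" for x
    using mult_support[OF f g finite_support[OF f] order_refl finite_support[OF g] order_refl] that
    by (metis (mono_tags, lifting) mem_Collect_eq subsetD)
  show "finite (case_prod cat ` (?S \<times> ?T) \<inter> C)"
    using finite_support f g by blast
qed auto

section \<open>Associativity\<close>

text \<open>The hypothesis \<open>\<phi> {} = \<zero>\<close> discards the pairs of classes that cannot be concatenated.\<close>

lemma mult_pairing:
  assumes f: "f \<in> carrier A" and g: "g \<in> carrier A" and \<phi>: "\<And>c. \<phi> c \<in> carrier K" "\<phi> {} = \<zero>"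
    and S: "finite S" "{c. f c \<noteq> \<zero>} \<subseteq> S" "S \<subseteq> C"
    and T: "finite T" "{d. g d \<noteq> \<zero>} \<subseteq> T" "T \<subseteq> C"
  defines "E \<equiv> case_prod cat ` (S \<times> T) \<inter> C"
  shows "(\<Oplus>e\<in>E. (f \<otimes>\<^bsub>A\<^esub> g) e \<otimes> \<phi> e) = (\<Oplus>c\<in>S. \<Oplus>d\<in>T. f c \<otimes> g d \<otimes> \<phi> (cat c d))"
proof -
  let ?t = "\<lambda>e c d. f c \<otimes> g d \<otimes> \<delta> e (cat c d) \<otimes> \<phi> e"
  have t: "?t e c d \<in> carrier K" for e c d using f g \<phi> by auto
  have finE: "finite E" using S T by (simp add: E_def)
  have "(\<Oplus>e\<in>E. (f \<otimes>\<^bsub>A\<^esub> g) e \<otimes> \<phi> e) = (\<Oplus>e\<in>E. \<Oplus>c\<in>S. \<Oplus>d\<in>T. ?t e c d)"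
  proof (rule finsum_cong')
    fix e assume "e \<in> E"
    then have e: "e \<in> C" by (simp add: E_def)
    show "(f \<otimes>\<^bsub>A\<^esub> g) e \<otimes> \<phi> e = (\<Oplus>c\<in>S. \<Oplus>d\<in>T. ?t e c d)"
      unfolding mult_apply[OF f g e S(1,2) T(1,2)]
      using f g \<phi> by (subst finsum_ldistr[OF S(1)])
        (auto intro!: finsum_closed finsum_cong' finsum_ldistr[OF T(1)])
  qed (use t in \<open>auto intro!: finsum_closed\<close>)
  \<comment> \<open>The sum over \<open>e\<close>, created by expanding the product, is moved
    innermost, where the Kronecker factor leaves only the term at
    \<open>e = cat c d\<close>.\<close>
  also have "\<dots> = (\<Oplus>c\<in>S. \<Oplus>e\<in>E. \<Oplus>d\<in>T. ?t e c d)"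
    using t finE by (intro finsum_swap) (auto intro!: finsum_closed)
  also have "\<dots> = (\<Oplus>c\<in>S. \<Oplus>d\<in>T. \<Oplus>e\<in>E. ?t e c d)"
    using t finE by (intro finsum_cong' finsum_swap) (auto intro!: finsum_closed)
  also have "\<dots> = (\<Oplus>c\<in>S. \<Oplus>d\<in>T. f c \<otimes> g d \<otimes> \<phi> (cat c d))"
  proof -
    have "(\<Oplus>e\<in>E. ?t e c d) = f c \<otimes> g d \<otimes> \<phi> (cat c d)" if cd: "c \<in> S" "d \<in> T" for c d
    proof (cases "cat c d = {}")
      \<comment> \<open>As \<open>E\<close> consists of classes, no \<open>e\<close> in it equals
        \<open>{}\<close>, so the inner sum is zero; the right-hand side agrees because \<phi>
        vanishes at \<open>{}\<close>.\<close>
      case True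
      then have "?t e c d = \<zero>" if "e \<in> E" for e
        using that empty_notin_poincare_classes[of G] f g \<phi> by (auto simp: E_def basis_elt_def)
      then have "(\<Oplus>e\<in>E. ?t e c d) = \<zero>" by (rule add.finprod_one_eqI)
      then show ?thesis using True f g \<phi> by simp
    next
      case False
      then have mem: "cat c d \<in> E"
        using cd S(3) T(3) G.hconcat_closed[of c d] False unfolding E_def
        by (intro IntI image_eqI[of _ _ "(c, d)"]) auto
      have "(\<Oplus>e\<in>E. ?t e c d) = (\<Oplus>e\<in>E. if cat c d = e then f c \<otimes> g d \<otimes> \<phi> e else \<zero>)"
        using f g \<phi> by (intro finsum_cong') (auto simp: basis_elt_def)
      also have "\<dots> = f c \<otimes> g d \<otimes> \<phi> (cat c d)"
        using f g \<phi> by (intro finsum_singleton[OF mem finE]) auto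
      finally show ?thesis .
    qed
    then show ?thesis
      using f g \<phi> by (intro finsum_cong') (auto intro!: finsum_closed finsum_cong')
  qed
  finally show ?thesis .
qed

text \<open>Both coefficients at \<open>x\<close> equal the triple sum of
  \<open>f c \<otimes> g d \<otimes> h b\<close> over the triples whose concatenation is
  \<open>x\<close>. Each bracketing reaches it by one use of \<open>mult_pairing\<close>, and
  \<open>hconcat_assoc\<close> identifies the two.\<close>

lemma mult_assoc:
  assumes f: "f \<in> carrier A" and g: "g \<in> carrier A" and h: "h \<in> carrier A"
  shows "f \<otimes>\<^bsub>A\<^esub> g \<otimes>\<^bsub>A\<^esub> h = f \<otimes>\<^bsub>A\<^esub> (g \<otimes>\<^bsub>A\<^esub> h)"
proof
  fix x
  define S where "S = {x. f x \<noteq> \<zero>}"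
  define T where "T = {x. g x \<noteq> \<zero>}"
  define U where "U = {x. h x \<noteq> \<zero>}"
  have S: "finite S" "{c. f c \<noteq> \<zero>} \<subseteq> S" "S \<subseteq> C"
    and T: "finite T" "{c. g c \<noteq> \<zero>} \<subseteq> T" "T \<subseteq> C"
    and U: "finite U" "{c. h c \<noteq> \<zero>} \<subseteq> U" "U \<subseteq> C"
    using finite_support support_subset f g h unfolding S_def T_def U_def by auto
  define E where "E = case_prod cat ` (S \<times> T) \<inter> C"
  define E' where "E' = case_prod cat ` (T \<times> U) \<inter> C"
  have E: "finite E" "{e. (f \<otimes>\<^bsub>A\<^esub> g) e \<noteq> \<zero>} \<subseteq> E"
    unfolding E_def by (intro finite_Int disjI1 finite_imageI finite_cartesian_product S(1) T(1),
        rule mult_support[OF f g S(1,2) T(1,2)])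
  have E': "finite E'" "{e. (g \<otimes>\<^bsub>A\<^esub> h) e \<noteq> \<zero>} \<subseteq> E'"
    unfolding E'_def by (intro finite_Int disjI1 finite_imageI finite_cartesian_product T(1) U(1),
        rule mult_support[OF g h T(1,2) U(1,2)])
  note fg = mult_closed[OF f g] and gh = mult_closed[OF g h]
  show "(f \<otimes>\<^bsub>A\<^esub> g \<otimes>\<^bsub>A\<^esub> h) x = (f \<otimes>\<^bsub>A\<^esub> (g \<otimes>\<^bsub>A\<^esub> h)) x"
  proof (cases "x \<in> C")
    case x: True
    then have [simp]: "\<delta> x {} = \<zero>"
      using empty_notin_poincare_classes[of G] by (auto simp: basis_elt_def)
    \<comment> \<open>Collects everything that depends on the composite of the first two classes; it
      vanishes at \<open>{}\<close> because \<open>cat {} b\<close> is again \<open>{}\<close>,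
      where \<open>\<delta> x\<close> is zero.\<close>
    define \<phi> where "\<phi> e = (\<Oplus>b\<in>U. h b \<otimes> \<delta> x (cat e b))" for e
    have \<phi>: "\<phi> e \<in> carrier K" "\<phi> {} = \<zero>" for e
      using h by (auto simp: \<phi>_def intro!: finsum_closed add.finprod_one_eqI)
    have "(f \<otimes>\<^bsub>A\<^esub> g \<otimes>\<^bsub>A\<^esub> h) x = (\<Oplus>e\<in>E. (f \<otimes>\<^bsub>A\<^esub> g) e \<otimes> \<phi> e)"
      unfolding mult_apply[OF fg h x E U(1,2)] \<phi>_def
      using fg h by (intro finsum_cong')
        (auto simp: m_assoc finsum_rdistr[OF U(1)] intro!: finsum_closed)
    also have "\<dots> = (\<Oplus>c\<in>S. \<Oplus>d\<in>T. f c \<otimes> g d \<otimes> \<phi> (cat c d))"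
      unfolding E_def by (rule mult_pairing[where \<phi> = \<phi>, OF f g \<phi> S T])
    also have "\<dots> = (\<Oplus>c\<in>S. f c \<otimes> (\<Oplus>d\<in>T. \<Oplus>b\<in>U. g d \<otimes> h b \<otimes> \<delta> x (cat c (cat d b))))"
    proof (rule finsum_cong'[OF HOL.refl])
      fix c assume c: "c \<in> S"
      have "f c \<otimes> g d \<otimes> \<phi> (cat c d) = f c \<otimes> (\<Oplus>b\<in>U. g d \<otimes> h b \<otimes> \<delta> x (cat c (cat d b)))"
        if d: "d \<in> T" for d
      proof -
        have "\<phi> (cat c d) = (\<Oplus>b\<in>U. h b \<otimes> \<delta> x (cat c (cat d b)))"
          unfolding \<phi>_def using h G.hconcat_assoc[OF subsetD[OF S(3) c] subsetD[OF T(3) d] subsetD[OF U(3)]]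
          by (intro finsum_cong') auto
        then have "g d \<otimes> \<phi> (cat c d) = (\<Oplus>b\<in>U. g d \<otimes> (h b \<otimes> \<delta> x (cat c (cat d b))))"
          using g h by (simp add: finsum_rdistr[OF U(1)])
        also have "\<dots> = (\<Oplus>b\<in>U. g d \<otimes> h b \<otimes> \<delta> x (cat c (cat d b)))"
          using g h by (intro finsum_cong') (auto simp: m_assoc)
        finally show ?thesis using f g \<phi> by (simp add: m_assoc)
      qed
      then have "(\<Oplus>d\<in>T. f c \<otimes> g d \<otimes> \<phi> (cat c d)) =
          (\<Oplus>d\<in>T. f c \<otimes> (\<Oplus>b\<in>U. g d \<otimes> h b \<otimes> \<delta> x (cat c (cat d b))))"
        using f g h by (intro finsum_cong') (auto intro!: finsum_closed)
      then show "(\<Oplus>d\<in>T. f c \<otimes> g d \<otimes> \<phi> (cat c d)) =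
          f c \<otimes> (\<Oplus>d\<in>T. \<Oplus>b\<in>U. g d \<otimes> h b \<otimes> \<delta> x (cat c (cat d b)))"
        using f g h by (subst finsum_rdistr[OF T(1)]) (auto intro!: finsum_closed)
    qed (use f g h in \<open>auto intro!: finsum_closed\<close>)
    also have "\<dots> = (\<Oplus>c\<in>S. f c \<otimes> (\<Oplus>e\<in>E'. (g \<otimes>\<^bsub>A\<^esub> h) e \<otimes> \<delta> x (cat c e)))"
    proof (rule finsum_cong'[OF HOL.refl])
      fix c assume "c \<in> S"
      show "f c \<otimes> (\<Oplus>d\<in>T. \<Oplus>b\<in>U. g d \<otimes> h b \<otimes> \<delta> x (cat c (cat d b))) =
          f c \<otimes> (\<Oplus>e\<in>E'. (g \<otimes>\<^bsub>A\<^esub> h) e \<otimes> \<delta> x (cat c e))"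
        \<comment> \<open>The second use of \<open>mult_pairing\<close>, for \<open>g\<close> and
          \<open>h\<close> with \<open>c\<close> fixed: the test function
          \<open>\<delta> x (cat c e)\<close> also vanishes at \<open>e = {}\<close>.\<close>
        unfolding E'_def
        by (subst mult_pairing[where \<phi> = "\<lambda>e. \<delta> x (cat c e)", OF g h _ _ T U]) simp_all
    qed (use f gh in \<open>auto intro!: finsum_closed\<close>)
    also have "\<dots> = (f \<otimes>\<^bsub>A\<^esub> (g \<otimes>\<^bsub>A\<^esub> h)) x"
      unfolding mult_apply[OF f gh x S(1,2) E']
      using f gh by (intro finsum_cong') (auto simp: m_assoc finsum_rdistr[OF E'(1)] intro!: finsum_closed)
    finally show ?thesis .
  qed (simp add: mult_apply_outside)
qed

section \<open>Additive structure, distributivity and scalars\<close>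

lemma abelian_group_poincare_algebra: "abelian_group A"
proof (rule abelian_groupI)
  fix f g assume fg: "f \<in> carrier A" "g \<in> carrier A"
  show "f \<oplus>\<^bsub>A\<^esub> g \<in> carrier A"
    using fg finite_support[of f] finite_support[of g] support_subset[of f] support_subset[of g]
    by (intro carrierI[of _ "{x. f x \<noteq> \<zero>} \<union> {x. g x \<noteq> \<zero>}"]) (auto simp: add_apply)
  show "f \<oplus>\<^bsub>A\<^esub> g = g \<oplus>\<^bsub>A\<^esub> f"
    using fg by (intro ext) (simp add: add_apply a_comm)
next
  fix f assume f: "f \<in> carrier A"
  have "(\<lambda>x. \<ominus> f x) \<in> carrier A"
    using f finite_support support_subset
    by (intro carrierI[of _ "{x. f x \<noteq> \<zero>}"]) auto
  moreover have "(\<lambda>x. \<ominus> f x) \<oplus>\<^bsub>A\<^esub> f = \<zero>\<^bsub>A\<^esub>"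
    using f by (intro ext) (simp add: add_apply zero_apply l_neg)
  ultimately show "\<exists>g\<in>carrier A. g \<oplus>\<^bsub>A\<^esub> f = \<zero>\<^bsub>A\<^esub>" by blast
  show "\<zero>\<^bsub>A\<^esub> \<oplus>\<^bsub>A\<^esub> f = f"
    using f by (intro ext) (simp add: add_apply zero_apply)
next
  show "\<zero>\<^bsub>A\<^esub> \<in> carrier A"
    by (intro carrierI[of _ "{}"]) (auto simp: zero_apply)
  show "f \<oplus>\<^bsub>A\<^esub> g \<oplus>\<^bsub>A\<^esub> h = f \<oplus>\<^bsub>A\<^esub> (g \<oplus>\<^bsub>A\<^esub> h)"
    if "f \<in> carrier A" "g \<in> carrier A" "h \<in> carrier A" for f g h
    using that by (intro ext) (simp add: add_apply a_assoc)
qed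

sublocale A: abelian_group A
  by (rule abelian_group_poincare_algebra)

text \<open>Evaluation at a fixed class is additive, so sums in the algebra can be computed
  coefficient by coefficient.\<close>

lemma finsum_apply:
  assumes "F \<in> I \<rightarrow> carrier A"
  shows "finsum A F I x = (\<Oplus>i\<in>I. F i x)"
  by (rule additive_hom_finsum[of A K "\<lambda>f. f x"])
    (use assms in \<open>auto simp: add_apply abelian_group_poincare_algebra abelian_group_axioms\<close>)

lemma mult_l_distr:
  assumes f: "f \<in> carrier A" and g: "g \<in> carrier A" and h: "h \<in> carrier A"
  shows "(f \<oplus>\<^bsub>A\<^esub> g) \<otimes>\<^bsub>A\<^esub> h = f \<otimes>\<^bsub>A\<^esub> h \<oplus>\<^bsub>A\<^esub> g \<otimes>\<^bsub>A\<^esub> h"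
proof
  fix x
  \<comment> \<open>The union of both supports also contains the support of the sum, so all three
    products become sums over one rectangle.\<close>
  define S where "S = {x. f x \<noteq> \<zero>} \<union> {x. g x \<noteq> \<zero>}"
  define T where "T = {x. h x \<noteq> \<zero>}"
  have S: "finite S" "{c. f c \<noteq> \<zero>} \<subseteq> S" "{c. g c \<noteq> \<zero>} \<subseteq> S"
      "{c. (f \<oplus>\<^bsub>A\<^esub> g) c \<noteq> \<zero>} \<subseteq> S"
    and T: "finite T" "{c. h c \<noteq> \<zero>} \<subseteq> T"
    using finite_support f g h unfolding S_def T_def by (auto simp: add_apply)
  show "((f \<oplus>\<^bsub>A\<^esub> g) \<otimes>\<^bsub>A\<^esub> h) x = (f \<otimes>\<^bsub>A\<^esub> h \<oplus>\<^bsub>A\<^esub> g \<otimes>\<^bsub>A\<^esub> h) x"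
  proof (cases "x \<in> C")
    case x: True
    have "((f \<oplus>\<^bsub>A\<^esub> g) \<otimes>\<^bsub>A\<^esub> h) x = (\<Oplus>c\<in>S. \<Oplus>d\<in>T. f c \<otimes> h d \<otimes> \<delta> x (cat c d) \<oplus> g c \<otimes> h d \<otimes> \<delta> x (cat c d))"
      unfolding mult_apply[OF A.a_closed[OF f g] h x S(1,4) T]
      using f g h by (intro finsum_cong') (auto simp: add_apply l_distr intro!: finsum_closed finsum_cong')
    also have "\<dots> = (f \<otimes>\<^bsub>A\<^esub> h) x \<oplus> (g \<otimes>\<^bsub>A\<^esub> h) x"
      unfolding mult_apply[OF f h x S(1,2) T] mult_apply[OF g h x S(1,3) T]
      using f g h by (subst finsum_addf[symmetric])
        (auto intro!: finsum_cong' finsum_addf finsum_closed)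
    finally show ?thesis by (simp add: add_apply)
  qed (simp add: add_apply mult_apply_outside)
qed

lemma mult_r_distr:
  assumes f: "f \<in> carrier A" and g: "g \<in> carrier A" and h: "h \<in> carrier A"
  shows "h \<otimes>\<^bsub>A\<^esub> (f \<oplus>\<^bsub>A\<^esub> g) = h \<otimes>\<^bsub>A\<^esub> f \<oplus>\<^bsub>A\<^esub> h \<otimes>\<^bsub>A\<^esub> g"
proof
  fix x
  define S where "S = {x. f x \<noteq> \<zero>} \<union> {x. g x \<noteq> \<zero>}"
  define T where "T = {x. h x \<noteq> \<zero>}"
  have S: "finite S" "{c. f c \<noteq> \<zero>} \<subseteq> S" "{c. g c \<noteq> \<zero>} \<subseteq> S"
      "{c. (f \<oplus>\<^bsub>A\<^esub> g) c \<noteq> \<zero>} \<subseteq> S"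
    and T: "finite T" "{c. h c \<noteq> \<zero>} \<subseteq> T"
    using finite_support f g h unfolding S_def T_def by (auto simp: add_apply)
  show "(h \<otimes>\<^bsub>A\<^esub> (f \<oplus>\<^bsub>A\<^esub> g)) x = (h \<otimes>\<^bsub>A\<^esub> f \<oplus>\<^bsub>A\<^esub> h \<otimes>\<^bsub>A\<^esub> g) x"
  proof (cases "x \<in> C")
    case x: True
    have "(h \<otimes>\<^bsub>A\<^esub> (f \<oplus>\<^bsub>A\<^esub> g)) x = (\<Oplus>d\<in>T. \<Oplus>c\<in>S. h d \<otimes> f c \<otimes> \<delta> x (cat d c) \<oplus> h d \<otimes> g c \<otimes> \<delta> x (cat d c))"
      unfolding mult_apply[OF h A.a_closed[OF f g] x T S(1,4)]
      using f g h by (intro finsum_cong') (auto simp: add_apply l_distr r_distr intro!: finsum_closed finsum_cong')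
    also have "\<dots> = (h \<otimes>\<^bsub>A\<^esub> f) x \<oplus> (h \<otimes>\<^bsub>A\<^esub> g) x"
      unfolding mult_apply[OF h f x T S(1,2)] mult_apply[OF h g x T S(1,3)]
      using f g h by (subst finsum_addf[symmetric])
        (auto intro!: finsum_cong' finsum_addf finsum_closed)
    finally show ?thesis by (simp add: add_apply)
  qed (simp add: add_apply mult_apply_outside)
qed

lemma smult_in_carrier:
  assumes "a \<in> carrier K" "f \<in> carrier A"
  shows "a \<odot>\<^bsub>A\<^esub> f \<in> carrier A"
  using assms finite_support[of f] support_subset[of f]
  by (intro carrierI[of _ "{x. f x \<noteq> \<zero>}"]) (auto simp: smult_apply)

lemma smult_mult:
  assumes a: "a \<in> carrier K" and f: "f \<in> carrier A" and g: "g \<in> carrier A"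
  shows "(a \<odot>\<^bsub>A\<^esub> f) \<otimes>\<^bsub>A\<^esub> g = a \<odot>\<^bsub>A\<^esub> (f \<otimes>\<^bsub>A\<^esub> g)"
    and "f \<otimes>\<^bsub>A\<^esub> (a \<odot>\<^bsub>A\<^esub> g) = a \<odot>\<^bsub>A\<^esub> (f \<otimes>\<^bsub>A\<^esub> g)"
proof -
  \<comment> \<open>Multiplication by \<open>a\<close> may shrink the support, as \<open>K\<close>
    can have zero divisors; \<open>S\<close> and \<open>T\<close> remain admissible index
    sets.\<close>
  define S where "S = {x. f x \<noteq> \<zero>}"
  define T where "T = {x. g x \<noteq> \<zero>}"
  have S: "finite S" "{c. f c \<noteq> \<zero>} \<subseteq> S" "{c. (a \<odot>\<^bsub>A\<^esub> f) c \<noteq> \<zero>} \<subseteq> S"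
    and T: "finite T" "{c. g c \<noteq> \<zero>} \<subseteq> T" "{c. (a \<odot>\<^bsub>A\<^esub> g) c \<noteq> \<zero>} \<subseteq> T"
    using finite_support a f g unfolding S_def T_def by (auto simp: smult_apply)
  have *: "a \<otimes> (f \<otimes>\<^bsub>A\<^esub> g) x = (\<Oplus>c\<in>S. \<Oplus>d\<in>T. a \<otimes> (f c \<otimes> g d \<otimes> \<delta> x (cat c d)))" if x: "x \<in> C" for x
    unfolding mult_apply[OF f g x S(1,2) T(1,2)]
    using a f g by (subst finsum_rdistr[OF S(1)])
      (auto intro!: finsum_closed finsum_cong' finsum_rdistr[OF T(1)])
  show "(a \<odot>\<^bsub>A\<^esub> f) \<otimes>\<^bsub>A\<^esub> g = a \<odot>\<^bsub>A\<^esub> (f \<otimes>\<^bsub>A\<^esub> g)"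
  proof
    fix x show "((a \<odot>\<^bsub>A\<^esub> f) \<otimes>\<^bsub>A\<^esub> g) x = (a \<odot>\<^bsub>A\<^esub> (f \<otimes>\<^bsub>A\<^esub> g)) x"
    proof (cases "x \<in> C")
      case x: True
      show ?thesis
        unfolding smult_apply[of a "f \<otimes>\<^bsub>A\<^esub> g"] *[OF x]
          mult_apply[OF smult_in_carrier[OF a f] g x S(1,3) T(1,2)]
        using a f g by (intro finsum_cong')
          (auto simp: smult_apply m_assoc intro!: finsum_closed finsum_cong')
    qed (use a in \<open>simp add: mult_apply_outside smult_apply\<close>)
  qed
  show "f \<otimes>\<^bsub>A\<^esub> (a \<odot>\<^bsub>A\<^esub> g) = a \<odot>\<^bsub>A\<^esub> (f \<otimes>\<^bsub>A\<^esub> g)"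
  proof
    fix x show "(f \<otimes>\<^bsub>A\<^esub> (a \<odot>\<^bsub>A\<^esub> g)) x = (a \<odot>\<^bsub>A\<^esub> (f \<otimes>\<^bsub>A\<^esub> g)) x"
    proof (cases "x \<in> C")
      case x: True
      show ?thesis
        unfolding smult_apply[of a "f \<otimes>\<^bsub>A\<^esub> g"] *[OF x]
          mult_apply[OF f smult_in_carrier[OF a g] x S(1,2) T(1,3)]
        using a f g by (intro finsum_cong')
          (auto simp: smult_apply m_ac intro!: finsum_closed finsum_cong')
    qed (use a in \<open>simp add: mult_apply_outside smult_apply\<close>)
  qed
qed

section \<open>Constant paths and the unit\<close>

abbreviation "const i \<equiv> hclass G (i, [], i)"

lemma const_in_classes: "i \<in> pverts G \<Longrightarrow> const i \<in> C"
  by (simp add: poincare_classes_eq G.paths_Nil_iff)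

lemma hclass_in_classes: "(u, p, v) \<in> paths G \<Longrightarrow> hclass G (u, p, v) \<in> C"
  by (simp add: poincare_classes_eq)

lemma const_eq_hclass:
  "i \<in> pverts G \<Longrightarrow> (u, p, v) \<in> paths G \<Longrightarrow> hclass G (u, p, v) = const i \<Longrightarrow> u = i \<and> v = i"
  using hclass_endpoints[of u p v G i "[]" i] by (simp add: G.paths_Nil_iff)

lemma cat_const:
  assumes "(u, p, v) \<in> paths G" "i \<in> pverts G"
  shows "cat (hclass G (u, p, v)) (const i) = (if v = i then hclass G (u, p, v) else {})"
    and "cat (const i) (hclass G (u, p, v)) = (if u = i then hclass G (u, p, v) else {})"
  using assms G.hconcat_hclass[of u p v i "[]" i] G.hconcat_hclass[of i "[]" i u p v]
  by (auto simp: G.paths_Nil_iff)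

text \<open>Concatenation with a constant class returns \<open>c\<close> or \<open>{}\<close>, and
  \<open>{}\<close> is not the class of a path. The endpoint of \<open>c\<close> only matters when
  \<open>c\<close> is the class of \<open>(u, p, v)\<close>, and then it can be read off from that
  path.\<close>

lemma \<delta>_cat_const:
  assumes x: "(u, p, v) \<in> paths G" and c: "c \<in> C" and i: "i \<in> pverts G"
  shows "\<delta> (hclass G (u, p, v)) (cat c (const i)) = (if hclass G (u, p, v) = c then if v = i then \<one> else \<zero> else \<zero>)"
    and "\<delta> (hclass G (u, p, v)) (cat (const i) c) = (if hclass G (u, p, v) = c then if u = i then \<one> else \<zero> else \<zero>)"
proof -
  have "hclass G (u, p, v) \<noteq> {}"
    using hclass_in_classes[OF x] empty_notin_poincare_classes[of G] by auto
  moreover obtain u' p' v' where c': "(u', p', v') \<in> paths G" "c = hclass G (u', p', v')"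
    using c by (rule poincare_classes_cases)
  moreover have "u = u' \<and> v = v'" if "hclass G (u, p, v) = hclass G (u', p', v')"
    using x c'(1) that by (rule hclass_endpoints)
  ultimately
  show "\<delta> (hclass G (u, p, v)) (cat c (const i)) = (if hclass G (u, p, v) = c then if v = i then \<one> else \<zero> else \<zero>)"
    and "\<delta> (hclass G (u, p, v)) (cat (const i) c) = (if hclass G (u, p, v) = c then if u = i then \<one> else \<zero> else \<zero>)"
    using cat_const[OF c'(1) i] by (auto simp: basis_elt_def)
qed

text \<open>Multiplication by a constant path is a Peirce projection. Both the unit law and the
  corner identity for the Laplace operator reduce to these coefficient formulas.\<close>

lemma mult_const_apply:
  assumes f: "f \<in> carrier A" and i: "i \<in> pverts G" and x: "(u, p, v) \<in> paths G"
  shows "(f \<otimes>\<^bsub>A\<^esub> \<delta> (const i)) (hclass G (u, p, v)) = (if v = i then f (hclass G (u, p, v)) else \<zero>)"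
    and "(\<delta> (const i) \<otimes>\<^bsub>A\<^esub> f) (hclass G (u, p, v)) = (if u = i then f (hclass G (u, p, v)) else \<zero>)"
proof -
  let ?x = "hclass G (u, p, v)"
  \<comment> \<open>The class \<open>?x\<close> is inserted by hand because its coefficient may be
    zero, while \<open>finsum_singleton\<close> requires it to be an index.\<close>
  define S where "S = insert ?x {c. f c \<noteq> \<zero>}"
  have S: "finite S" "{c. f c \<noteq> \<zero>} \<subseteq> S" and SC: "S \<subseteq> C" and xS: "?x \<in> S"
    using finite_support[OF f] support_subset[OF f] hclass_in_classes[OF x] by (auto simp: S_def)
  have T: "finite {const i}" "{d. \<delta> (const i) d \<noteq> \<zero>} \<subseteq> {const i}"
    by (auto simp: basis_elt_def)
  have one: "\<delta> (const i) (const i) = \<one>" by (simp add: basis_elt_def)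
  note e = \<delta>_in_carrier[OF const_in_classes[OF i]]
  have "(f \<otimes>\<^bsub>A\<^esub> \<delta> (const i)) ?x = (\<Oplus>c\<in>S. if ?x = c then if v = i then f c else \<zero> else \<zero>)"
    unfolding mult_apply[OF f e hclass_in_classes[OF x] S T]
    using f SC by (intro finsum_cong') (auto simp: \<delta>_cat_const[OF x subsetD[OF SC] i] one)
  also have "\<dots> = (if v = i then f ?x else \<zero>)"
    using f by (intro finsum_singleton[OF xS S(1)]) auto
  finally show "(f \<otimes>\<^bsub>A\<^esub> \<delta> (const i)) ?x = (if v = i then f ?x else \<zero>)" .
  have "(\<delta> (const i) \<otimes>\<^bsub>A\<^esub> f) ?x = (\<Oplus>c\<in>S. if ?x = c then if u = i then f c else \<zero> else \<zero>)"
    unfolding mult_apply[OF e f hclass_in_classes[OF x] T S]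
    using f SC by (subst finsum_insert) (auto simp: \<delta>_cat_const[OF x subsetD[OF SC] i] one intro!: finsum_closed finsum_cong')
  also have "\<dots> = (if u = i then f ?x else \<zero>)"
    using f by (intro finsum_singleton[OF xS S(1)]) auto
  finally show "(\<delta> (const i) \<otimes>\<^bsub>A\<^esub> f) ?x = (if u = i then f ?x else \<zero>)" .
qed

lemma \<delta>_const_Pi: "(\<lambda>i. \<delta> (const i)) \<in> pverts G \<rightarrow> carrier A"
  by (auto intro: \<delta>_in_carrier const_in_classes)

text \<open>The unit is given as the indicator of the set of constant classes. It equals the sum
  because constant paths at distinct vertices have distinct endpoints, hence distinct classes, so no
  class is counted twice.\<close>

lemma one_eq_finsum: "\<one>\<^bsub>A\<^esub> = finsum A (\<lambda>i. \<delta> (const i)) (pverts G)"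
proof
  fix x
  have "finsum A (\<lambda>i. \<delta> (const i)) (pverts G) x = (\<Oplus>i\<in>pverts G. \<delta> (const i) x)"
    by (rule finsum_apply[OF \<delta>_const_Pi])
  also have "\<dots> = \<one>\<^bsub>A\<^esub> x"
  proof (cases "x \<in> const ` pverts G")
    case True
    then obtain j where j: "j \<in> pverts G" "x = const j" by blast
    have "(\<Oplus>i\<in>pverts G. \<delta> (const i) x) = (\<Oplus>i\<in>pverts G. if j = i then \<one> else \<zero>)"
      using j const_eq_hclass[of _ j "[]" j]
      by (intro finsum_cong') (auto simp: basis_elt_def G.paths_Nil_iff)
    also have "\<dots> = \<one>"
      using j G.pair_finite_verts by (intro finsum_singleton) auto
    finally show ?thesis using True by (simp add: one_apply)
  next
    case False
    then have "(\<Oplus>i\<in>pverts G. \<delta> (const i) x) = \<zero>"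
      by (intro add.finprod_one_eqI) (auto simp: basis_elt_def)
    then show ?thesis using False by (simp add: one_apply)
  qed
  finally show "\<one>\<^bsub>A\<^esub> x = finsum A (\<lambda>i. \<delta> (const i)) (pverts G) x" by simp
qed

lemma one_in_carrier: "\<one>\<^bsub>A\<^esub> \<in> carrier A"
  unfolding one_eq_finsum by (rule A.finsum_closed[OF \<delta>_const_Pi])

text \<open>Each class has one start and one end vertex, so in the expansion of the unit exactly one
  summand contributes to a given coefficient.\<close>

lemma mult_one:
  assumes f: "f \<in> carrier A"
  shows "f \<otimes>\<^bsub>A\<^esub> \<one>\<^bsub>A\<^esub> = f" and "\<one>\<^bsub>A\<^esub> \<otimes>\<^bsub>A\<^esub> f = f"
proof -
  have r: "f \<otimes>\<^bsub>A\<^esub> \<one>\<^bsub>A\<^esub> = finsum A (\<lambda>i. f \<otimes>\<^bsub>A\<^esub> \<delta> (const i)) (pverts G)"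
    unfolding one_eq_finsum
    by (rule additive_hom_finsum[of A A "\<lambda>g. f \<otimes>\<^bsub>A\<^esub> g"])
      (use f \<delta>_const_Pi in \<open>auto simp: mult_closed mult_r_distr abelian_group_poincare_algebra\<close>)
  have l: "\<one>\<^bsub>A\<^esub> \<otimes>\<^bsub>A\<^esub> f = finsum A (\<lambda>i. \<delta> (const i) \<otimes>\<^bsub>A\<^esub> f) (pverts G)"
    unfolding one_eq_finsum
    by (rule additive_hom_finsum[of A A "\<lambda>g. g \<otimes>\<^bsub>A\<^esub> f"])
      (use f \<delta>_const_Pi in \<open>auto simp: mult_closed mult_l_distr abelian_group_poincare_algebra\<close>)
  have Pi: "(\<lambda>i. f \<otimes>\<^bsub>A\<^esub> \<delta> (const i)) \<in> pverts G \<rightarrow> carrier A"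
    "(\<lambda>i. \<delta> (const i) \<otimes>\<^bsub>A\<^esub> f) \<in> pverts G \<rightarrow> carrier A"
    using f \<delta>_const_Pi by (auto intro!: mult_closed)
  have "(f \<otimes>\<^bsub>A\<^esub> \<one>\<^bsub>A\<^esub>) x = f x \<and> (\<one>\<^bsub>A\<^esub> \<otimes>\<^bsub>A\<^esub> f) x = f x" for x
  proof (cases "x \<in> C")
    case True
    then obtain u p v where x: "(u, p, v) \<in> paths G" "x = hclass G (u, p, v)"
      by (rule poincare_classes_cases)
    then have uv: "u \<in> pverts G" "v \<in> pverts G" using G.paths_endpoints by blast+
    have "(f \<otimes>\<^bsub>A\<^esub> \<one>\<^bsub>A\<^esub>) x = (\<Oplus>i\<in>pverts G. if v = i then f x else \<zero>)"
      unfolding r finsum_apply[OF Pi(1)]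
      using f x by (intro finsum_cong') (auto simp: mult_const_apply)
    also have "\<dots> = f x"
      using f uv G.pair_finite_verts by (intro finsum_singleton) auto
    finally have 1: "(f \<otimes>\<^bsub>A\<^esub> \<one>\<^bsub>A\<^esub>) x = f x" .
    have "(\<one>\<^bsub>A\<^esub> \<otimes>\<^bsub>A\<^esub> f) x = (\<Oplus>i\<in>pverts G. if u = i then f x else \<zero>)"
      unfolding l finsum_apply[OF Pi(2)]
      using f x by (intro finsum_cong') (auto simp: mult_const_apply)
    also have "\<dots> = f x"
      using f uv G.pair_finite_verts by (intro finsum_singleton) auto
    finally show ?thesis using 1 by blast
  qed (simp add: mult_apply_outside coeff_zero[OF f])
  then show "f \<otimes>\<^bsub>A\<^esub> \<one>\<^bsub>A\<^esub> = f" "\<one>\<^bsub>A\<^esub> \<otimes>\<^bsub>A\<^esub> f = f" by auto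
qed

lemma assoc_algebra_poincare_algebra: "assoc_algebra K A"
proof (intro assoc_algebra.intro assoc_algebra_axioms.intro)
  show "Module.module K A"
  proof (rule moduleI[OF is_cring abelian_group_poincare_algebra])
    show "a \<odot>\<^bsub>A\<^esub> f \<in> carrier A" if "a \<in> carrier K" "f \<in> carrier A" for a f
      using that by (rule smult_in_carrier)
  qed (auto simp: fun_eq_iff smult_apply add_apply l_distr r_distr m_assoc)
  show "ring A"
  proof (rule ringI[OF abelian_group_poincare_algebra])
    show "monoid A"
      by (rule monoidI) (simp_all add: mult_closed one_in_carrier mult_assoc mult_one)
  qed (simp_all add: mult_l_distr mult_r_distr)
qed (simp_all add: smult_mult)

section \<open>The generalized Laplace operator\<close>

context
  fixes s :: "'v \<Rightarrow> 'v \<Rightarrow> 'k"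
  assumes s: "\<And>i j. (i, j) \<in> parcs G \<Longrightarrow> s i j \<in> carrier K"
begin

lemma weighted_edges_Pi:
  "(\<lambda>(i, j). s i j \<odot>\<^bsub>A\<^esub> edge_elt K G i j) \<in> parcs G \<rightarrow> carrier A"
  by (auto simp: edge_elt_def intro!: smult_in_carrier s \<delta>_in_carrier hclass_in_classes G.paths_arc)

lemma laplace_in_carrier: "laplace K G s \<in> carrier A"
  unfolding laplace_def by (intro A.a_closed one_in_carrier A.finsum_closed weighted_edges_Pi)

text \<open>An arc has distinct endpoints and homotopy preserves endpoints, so an edge class never
  contains a closed path; only the unit contributes. The closed path is arbitrary since the corner
  at \<open>i\<close> involves the whole fundamental group there.\<close>

lemma laplace_apply_loop:
  assumes "(i, p, i) \<in> paths G"
  shows "laplace K G s (hclass G (i, p, i)) = \<delta> (const i) (hclass G (i, p, i))"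
proof -
  let ?x = "hclass G (i, p, i)"
  have "?x \<noteq> hclass G (j, [(j, k)], k)" if "(j, k) \<in> parcs G" for j k
    using hclass_endpoints[OF assms G.paths_arc[OF that]] G.no_loops'[OF that] by blast
  then have "(\<Oplus>a\<in>parcs G. (case a of (j, k) \<Rightarrow> s j k \<odot>\<^bsub>A\<^esub> edge_elt K G j k) ?x) = \<zero>"
    using s by (intro add.finprod_one_eqI) (auto simp: smult_apply edge_elt_def basis_elt_def)
  moreover have "\<one>\<^bsub>A\<^esub> ?x = \<delta> (const i) ?x"
    using const_eq_hclass[OF _ assms] G.paths_endpoints[OF assms]
    by (auto simp: one_apply basis_elt_def)
  ultimately show ?thesis
    unfolding laplace_def add_apply finsum_apply[OF weighted_edges_Pi] by simp
qed

text \<open>The outer factors erase every coefficient except those at closed paths based at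
  \<open>i\<close>, where \<open>laplace_apply_loop\<close> gives the value.\<close>

lemma const_laplace_const:
  assumes i: "i \<in> pverts G"
  shows "\<delta> (const i) \<otimes>\<^bsub>A\<^esub> laplace K G s \<otimes>\<^bsub>A\<^esub> \<delta> (const i) = \<delta> (const i)" (is "?l = ?r")
proof
  note e = \<delta>_in_carrier[OF const_in_classes[OF i]]
  fix x show "?l x = ?r x"
  proof (cases "x \<in> C")
    case True
    then obtain u p v where x: "(u, p, v) \<in> paths G" "x = hclass G (u, p, v)"
      by (rule poincare_classes_cases)
    have "?l x = (if u = i \<and> v = i then laplace K G s x else \<zero>)"
      unfolding x(2) mult_const_apply(1)[OF mult_closed[OF e laplace_in_carrier] i x(1)]
        mult_const_apply(2)[OF laplace_in_carrier i x(1)] by simp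
    also have "\<dots> = ?r x"
    proof (cases "u = i \<and> v = i")
      case True
      then show ?thesis using laplace_apply_loop[of i p] x by simp
    next
      case False
      then have "x \<noteq> const i" using x const_eq_hclass[OF i x(1)] by blast
      then show ?thesis using False by (auto simp: basis_elt_def)
    qed
    finally show ?thesis .
  qed (simp add: mult_apply_outside coeff_zero[OF e])
qed

end

end

theorem lemma18:
  fixes K :: "('k, 'c) ring_scheme"
    and G :: "'v pair_pre_digraph"
    and s :: "'v \<Rightarrow> 'v \<Rightarrow> 'k"
  assumes "cring K"
    and "pair_graph G"
    and "\<And>i j. (i, j) \<in> parcs G \<Longrightarrow> s i j \<in> Units K"
    and "\<And>i j. (i, j) \<in> parcs G \<Longrightarrow> s i j = s j i"
  shows "well_tempered TYPE('m) TYPE('n) K (poincare_algebra K G) (laplace K G s)"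
proof -
  interpret poincare_groupoid K G
    using assms(1,2) by (simp add: poincare_groupoid_def)
  have s: "s i j \<in> carrier K" if "(i, j) \<in> parcs G" for i j
    using assms(3)[OF that] by (rule Units_closed)
  show ?thesis
    by (rule well_temperedI[of K A _ "pverts G" "\<lambda>i. \<delta> (const i)",
          OF assoc_algebra_poincare_algebra laplace_in_carrier[OF s] G.pair_finite_verts _
          const_laplace_const[OF s] one_eq_finsum[symmetric]])
      (auto intro: \<delta>_in_carrier const_in_classes)
qed

end
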